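(* Let $[\eta]_f, [\delta]_g \in \mathscr{H}_R(G, \mathscr{P}, V)$ with $\eta, \delta \in W$ and, in the case $l(\eta) > 1$, write $\eta = \eta' v$ with $v \in S = \{w, w'\}$. Then \begin{equation*} [\eta]_f\ast [\delta]_g = \begin{cases} [\eta\delta]_{fg} & \text{ if }l(\eta\delta) = l(\eta)+l(\delta);\\ \tau\,[\eta\delta]_{fg} + [\eta'\delta]_{fg}^1 & \text{ if }l(\eta) = l(\delta) =1 \text{ and } l(\eta\delta) = 0. \end{cases} \end{equation*} (No statement is made for the case $l(\eta\delta) \neq l(\eta)+l(\delta)$ and $\max(l(\eta), l(\delta)) > 1$.)
   Context: Let $F$ be a non-archimedean local field with ring of integers $\mathcal{O}$, uniformizer $\varpi$, residue field $\mathbb{F}_q$ of characteristic $p$; $R$ an algebraically closed field of characteristic $\ell \neq p$. Let $n = 2k$, $G = \operatorname{GL}_n(F)$, $\mathcal{M} = \operatorname{GL}_k(q) \times \operatorname{GL}_k(q)$, and $\mathscr{P} \subset G$ the standard parahoric subgroup with $\mathscr{P}/\mathscr{P}(1) \cong \mathcal{M}$. Let $(V, \sigma)$ be a finite-dimensional cuspidal (not necessarily irreducible) $R$-representation of $\mathcal{M}$, inflated to $\mathscr{P}$. $\mathscr{H}_R(G, \mathscr{P}, V) = \operatorname{End}_G(\operatorname{ind}_{\mathscr{P}}^G V)$ is the convolution algebra of functions $\varphi: G \to \operatorname{End}_R(V)$ with finite support in $\mathscr{P}\backslash G/\mathscr{P}$ and $\varphi(p_1 g p_2) = \sigma(p_1)\varphi(g)\sigma(p_2)$.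 Let $w$ be the block permutation matrix $\left(\begin{smallmatrix} 0 & 1_k \\ 1_k & 0\end{smallmatrix}\right)$, $t = \left(\begin{smallmatrix} 0 & 1_k \\ \varpi 1_k & 0\end{smallmatrix}\right)$, $w' = t w t^{-1}$, and let $W$ be the group generated by block-scalar diagonal matrices $\operatorname{diag}(\varpi^a 1_k, \varpi^b 1_k)$ and $w$; it is isomorphic to the affine Weyl group of $\operatorname{GL}_2(F)$, with length function $l$ satisfying $l(w) = l(w') = 1$, $l(t) = 0$. The support of $\mathscr{H}_R(G,\mathscr{P},V)$ lies in $\mathscr{P}W\mathscr{P}$; for $\eta \in W$, functions supported on $\mathscr{P}\eta\mathscr{P}$ are determined by their value at $\eta$, which lies in $I_1 = \operatorname{End}_{\mathcal{M}}(V)$ if $\eta$ is diagonal and in $I_w = \operatorname{Hom}_{\mathcal{M}}(V^w, V)$ otherwise; $[\eta]_f$ denotes the function supported on $\mathscr{P}\eta\mathscr{P}$ with value $f$ at $\eta$. Let $T^{\ast} = \sum_{g \in \operatorname{GL}_k(q)} \left(\begin{smallmatrix} g & \\ & -g^{-1}\end{smallmatrix}\right) \in R[\mathcal{M}]$ (acting on $V$), and $[\eta]^j_f := [\eta]_{(T^{\ast})^j f}$ (where parity of $j$ makes this meaningful). Let $\tau = q^{k^2} \bmod \ell \in \{1, \dots, \ell-1\}$.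
   Formalization: The decomposition η = η'v is taken when l(η) ≥ 1 (not only l(η) > 1, which leaves η' undefined where the formula uses it) and is required to be reduced, l(η) = l(η') + 1; with the other choice of v in S the second formula is false. *)

theory Defs
  imports "HOL-Analysis.Analysis" "HOL-Computational_Algebra.Computational_Algebra"
begin

section \<open>Non-archimedean local fields\<close>

text \<open>The normalised valuation \<open>val\<close> is only meaningful on nonzero elements; \<open>val_ge val N x\<close>
  says \<open>v(x) \<ge> N\<close> with the convention \<open>v(0) = \<infinity>\<close>.\<close>

definition val_ge :: "('f::field \<Rightarrow> int) \<Rightarrow> int \<Rightarrow> 'f \<Rightarrow> bool" where
  "val_ge val N x \<longleftrightarrow> x = 0 \<or> N \<le> val x"

definition integers :: "('f::field \<Rightarrow> int) \<Rightarrow> 'f set" where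
  "integers val = {x. val_ge val 0 x}"

definition max_ideal :: "('f::field \<Rightarrow> int) \<Rightarrow> 'f set" where
  "max_ideal val = {x. val_ge val 1 x}"

text \<open>A field complete with respect to a discrete valuation and with finite residue field. The
  residue field is a finite field type \<open>'q\<close>, identified with the ring of integers modulo its
  maximal ideal through the reduction map \<open>res\<close>; values of \<open>res\<close> outside the ring of integers
  are irrelevant.\<close>

locale nonarch_local_field =
  fixes val :: "'f::field \<Rightarrow> int"
    and res :: "'f \<Rightarrow> 'q::{field,finite}"
  assumes val_mult: "x \<noteq> 0 \<Longrightarrow> y \<noteq> 0 \<Longrightarrow> val (x * y) = val x + val y"
    and val_add: "x \<noteq> 0 \<Longrightarrow> y \<noteq> 0 \<Longrightarrow> x + y \<noteq> 0 \<Longrightarrow> min (val x) (val y) \<le> val (x + y)"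
    and val_normalised: "\<exists>x. x \<noteq> 0 \<and> val x = 1"
    and complete:
      "(\<And>N. \<exists>M. \<forall>m\<ge>M. \<forall>n\<ge>M. val_ge val N (X m - X n)) \<Longrightarrow>
        \<exists>L. \<forall>N. \<exists>M. \<forall>m\<ge>M. val_ge val N (X (m::nat) - L)"
    and res_one: "res 1 = 1"
    and res_add: "x \<in> integers val \<Longrightarrow> y \<in> integers val \<Longrightarrow> res (x + y) = res x + res y"
    and res_mult: "x \<in> integers val \<Longrightarrow> y \<in> integers val \<Longrightarrow> res (x * y) = res x * res y"
    and res_surj: "res ` integers val = UNIV"
    and res_kernel: "x \<in> integers val \<Longrightarrow> res x = 0 \<longleftrightarrow> x \<in> max_ideal val"

definition uniformizer :: "('f::field \<Rightarrow> int) \<Rightarrow> 'f \<Rightarrow> bool" where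
  "uniformizer val \<pi> \<longleftrightarrow> \<pi> \<noteq> 0 \<and> val \<pi> = 1"

section \<open>Block matrices and the parahoric subgroup\<close>

text \<open>With \<open>k = CARD('k)\<close>, a matrix of size \<open>n = 2k\<close> is indexed by \<open>'k + 'k\<close>; the summands
  index the two block rows and columns.\<close>

type_synonym ('a, 'k) bmat = "'a ^ ('k + 'k) ^ ('k + 'k)"

type_synonym ('q, 'k) levi = "('q ^ 'k ^ 'k) \<times> ('q ^ 'k ^ 'k)"

definition block :: "'a^'k^'k \<Rightarrow> 'a^'k^'k \<Rightarrow> 'a^'k^'k \<Rightarrow> 'a^'k^'k \<Rightarrow> ('a, 'k::finite) bmat" where
  "block A B C D = (\<chi> i j. case (i, j) of
      (Inl a, Inl b) \<Rightarrow> A $ a $ b | (Inl a, Inr b) \<Rightarrow> B $ a $ b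
    | (Inr a, Inl b) \<Rightarrow> C $ a $ b | (Inr a, Inr b) \<Rightarrow> D $ a $ b)"

definition GL :: "('a::field ^ 'n ^ 'n::finite) set" where
  "GL = {g. invertible g}"

definition GL_integers :: "('f::field \<Rightarrow> int) \<Rightarrow> ('f ^ 'n ^ 'n::finite) set" where
  "GL_integers val = {g \<in> GL. (\<forall>i j. g $ i $ j \<in> integers val) \<and>
     (\<forall>i j. matrix_inv g $ i $ j \<in> integers val)}"

definition parahoric :: "('f::field \<Rightarrow> int) \<Rightarrow> ('f, 'k::finite) bmat set" where
  "parahoric val = {g \<in> GL_integers val. \<forall>i j. g $ Inr i $ Inl j \<in> max_ideal val}"

definition Levi :: "('q::field, 'k::finite) levi set" where
  "Levi = GL \<times> GL"

text \<open>The quotient map from the parahoric subgroup onto its reductive quotient; its kernel is the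
  pro-unipotent radical.\<close>

definition reduction :: "('f::field \<Rightarrow> 'q::field) \<Rightarrow> ('f, 'k::finite) bmat \<Rightarrow> ('q, 'k) levi" where
  "reduction res g = ((\<chi> i j. res (g $ Inl i $ Inl j)), (\<chi> i j. res (g $ Inr i $ Inr j)))"

section \<open>Cuspidal representations of the finite Levi group\<close>

definition representation ::
    "('r::field \<Rightarrow> 'v::ab_group_add \<Rightarrow> 'v) \<Rightarrow> (('q::field, 'k::finite) levi \<Rightarrow> 'v \<Rightarrow> 'v) \<Rightarrow> bool" where
  "representation smul \<sigma> \<longleftrightarrow>
     (\<forall>m\<in>Levi. Vector_Spaces.linear smul smul (\<sigma> m)) \<and>
     \<sigma> (mat 1, mat 1) = id \<and>
     (\<forall>(a, b)\<in>Levi. \<forall>(c, d)\<in>Levi. \<sigma> (a ** c, b ** d) = \<sigma> (a, b) \<circ> \<sigma> (c, d))"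

text \<open>A labelling \<open>c\<close> of the coordinates describes an ordered partition of the standard basis, hence
  the parabolic subgroup of all \<open>g\<close> with \<open>g $ i $ j = 0\<close> whenever \<open>c j < c i\<close>. Every parabolic subgroup
  of the general linear group is conjugate, by some \<open>x\<close>, to one of these, and it is proper iff \<open>c\<close>
  is not constant. The following set is the unipotent radical of that conjugate.\<close>

definition unipotent_radical ::
    "('k \<Rightarrow> nat) \<Rightarrow> 'q ^ 'k ^ 'k \<Rightarrow> ('q::field ^ 'k ^ 'k::finite) set" where
  "unipotent_radical c x = {x ** u ** matrix_inv x | u.
     u \<in> GL \<and> (\<forall>i j. c j \<le> c i \<longrightarrow> u $ i $ j = mat 1 $ i $ j)}"

text \<open>Cuspidality: the parabolic restriction (invariants under the unipotent radical) vanishes for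
  every proper parabolic subgroup of the product group.\<close>

definition cuspidal :: "(('q::field, 'k::finite) levi \<Rightarrow> 'v::ab_group_add \<Rightarrow> 'v) \<Rightarrow> bool" where
  "cuspidal \<sigma> \<longleftrightarrow>
     (\<forall>c d. \<forall>x\<in>GL. \<forall>y\<in>GL. \<not> (c constant_on UNIV \<and> d constant_on UNIV) \<longrightarrow>
        {v. \<forall>m \<in> unipotent_radical c x \<times> unipotent_radical d y. \<sigma> m v = v} = {0})"

definition intertwiners ::
    "('r::field \<Rightarrow> 'v::ab_group_add \<Rightarrow> 'v) \<Rightarrow> (('q::field, 'k::finite) levi \<Rightarrow> 'v \<Rightarrow> 'v)
      \<Rightarrow> (('q, 'k) levi \<Rightarrow> 'v \<Rightarrow> 'v) \<Rightarrow> ('v \<Rightarrow> 'v) set" where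
  "intertwiners smul \<sigma>1 \<sigma>2 = {f. Vector_Spaces.linear smul smul f \<and>
     (\<forall>m\<in>Levi. f \<circ> \<sigma>1 m = \<sigma>2 m \<circ> f)}"

text \<open>Conjugation by the block permutation matrix exchanges the two factors of the Levi group.\<close>

definition w_twist ::
    "(('q, 'k::finite) levi \<Rightarrow> 'v \<Rightarrow> 'v) \<Rightarrow> ('q, 'k) levi \<Rightarrow> 'v \<Rightarrow> 'v" where
  "w_twist \<sigma> m = \<sigma> (prod.swap m)"

definition T_star ::
    "(('q::field, 'k::finite) levi \<Rightarrow> 'v::ab_group_add \<Rightarrow> 'v) \<Rightarrow> 'v \<Rightarrow> 'v" where
  "T_star \<sigma> v = (\<Sum>g\<in>GL. \<sigma> (g, - matrix_inv g) v)"

section \<open>The extended affine Weyl group\<close>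

definition block_diag :: "'f::field \<Rightarrow> int \<Rightarrow> int \<Rightarrow> ('f, 'k::finite) bmat" where
  "block_diag \<pi> a b = block (mat (\<pi> powi a)) 0 0 (mat (\<pi> powi b))"

definition w_mat :: "('f::field, 'k::finite) bmat" where
  "w_mat = block 0 (mat 1) (mat 1) 0"

definition t_mat :: "'f::field \<Rightarrow> ('f, 'k::finite) bmat" where
  "t_mat \<pi> = block 0 (mat 1) (mat \<pi>) 0"

definition w'_mat :: "'f::field \<Rightarrow> ('f, 'k::finite) bmat" where
  "w'_mat \<pi> = t_mat \<pi> ** w_mat ** matrix_inv (t_mat \<pi>)"

definition simple_refls :: "'f::field \<Rightarrow> ('f, 'k::finite) bmat set" where
  "simple_refls \<pi> = {w_mat, w'_mat \<pi>}"

inductive_set Weyl :: "'f::field \<Rightarrow> ('f, 'k::finite) bmat set" for \<pi> :: 'f where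
  diag: "block_diag \<pi> a b \<in> Weyl \<pi>"
| w: "w_mat \<in> Weyl \<pi>"
| mult: "x \<in> Weyl \<pi> \<Longrightarrow> y \<in> Weyl \<pi> \<Longrightarrow> x ** y \<in> Weyl \<pi>"
| inv: "x \<in> Weyl \<pi> \<Longrightarrow> matrix_inv x \<in> Weyl \<pi>"

definition mat_powi :: "'a::field ^ 'n ^ 'n::finite \<Rightarrow> int \<Rightarrow> 'a ^ 'n ^ 'n" where
  "mat_powi A i = (if 0 \<le> i then ((**) A ^^ nat i) (mat 1)
                   else ((**) (matrix_inv A) ^^ nat (- i)) (mat 1))"

text \<open>The extended affine Weyl group is the semidirect product of the Coxeter group generated by the
  simple reflections and the infinite cyclic group generated by \<open>t\<close>. The length is the Coxeter length
  of the first component, so that powers of \<open>t\<close> have length zero.\<close>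

definition len :: "'f::field \<Rightarrow> ('f, 'k::finite) bmat \<Rightarrow> nat" where
  "len \<pi> \<eta> = (LEAST r. \<exists>ss i. length ss = r \<and> set ss \<subseteq> simple_refls \<pi> \<and>
     \<eta> = foldr (**) ss (mat_powi (t_mat \<pi>) i))"

section \<open>The Hecke algebra\<close>

definition double_coset ::
    "('f::field \<Rightarrow> int) \<Rightarrow> ('f, 'k::finite) bmat \<Rightarrow> ('f, 'k) bmat set" where
  "double_coset val g = {p1 ** g ** p2 | p1 p2. p1 \<in> parahoric val \<and> p2 \<in> parahoric val}"

definition left_cosets :: "('f::field \<Rightarrow> int) \<Rightarrow> ('f, 'k::finite) bmat set set" where
  "left_cosets val = {(**) h ` parahoric val | h. h \<in> GL}"

text \<open>Functions on the general linear group are represented by functions on all matrices that vanish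
  on the singular ones.\<close>

definition hecke_algebra ::
    "('r::field \<Rightarrow> 'v::ab_group_add \<Rightarrow> 'v) \<Rightarrow> ('f::field \<Rightarrow> int) \<Rightarrow> ('f \<Rightarrow> 'q::field)
      \<Rightarrow> (('q, 'k::finite) levi \<Rightarrow> 'v \<Rightarrow> 'v) \<Rightarrow> (('f, 'k) bmat \<Rightarrow> 'v \<Rightarrow> 'v) set" where
  "hecke_algebra smul val res \<sigma> = {\<phi>.
     (\<forall>g. g \<notin> GL \<longrightarrow> \<phi> g = (\<lambda>_. 0)) \<and>
     (\<forall>g\<in>GL. Vector_Spaces.linear smul smul (\<phi> g)) \<and>
     (\<forall>g\<in>GL. \<forall>p1\<in>parahoric val. \<forall>p2\<in>parahoric val.
        \<phi> (p1 ** g ** p2) = \<sigma> (reduction res p1) \<circ> \<phi> g \<circ> \<sigma> (reduction res p2)) \<and>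
     finite {double_coset val g | g. \<phi> g \<noteq> (\<lambda>_. 0)}}"

text \<open>\<open>(\<phi> * \<psi>)(g)\<close> is the sum of \<open>\<phi>(h) \<psi>(h\<^sup>-\<^sup>1 g)\<close> over the left cosets \<open>h\<P>\<close> of the parahoric
  subgroup \<open>\<P>\<close>. For \<open>\<phi>\<close> and \<open>\<psi>\<close> in the Hecke algebra the summand only depends on the coset and only the
  finitely many cosets in the support of \<open>\<phi>\<close> contribute.\<close>

definition convolution ::
    "('f::field \<Rightarrow> int) \<Rightarrow> (('f, 'k::finite) bmat \<Rightarrow> 'v::ab_group_add \<Rightarrow> 'v)
      \<Rightarrow> (('f, 'k) bmat \<Rightarrow> 'v \<Rightarrow> 'v) \<Rightarrow> ('f, 'k) bmat \<Rightarrow> 'v \<Rightarrow> 'v" where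
  "convolution val \<phi> \<psi> g v =
     (\<Sum>C\<in>{C \<in> left_cosets val. \<exists>h\<in>C. \<phi> h \<noteq> (\<lambda>_. 0)}.
        let h = (SOME h. h \<in> C) in \<phi> h (\<psi> (matrix_inv h ** g) v))"

definition is_diagonal :: "('f::field, 'k::finite) bmat \<Rightarrow> bool" where
  "is_diagonal \<eta> \<longleftrightarrow> (\<forall>i j. i \<noteq> j \<longrightarrow> \<eta> $ i $ j = 0)"

definition coeff_space ::
    "('r::field \<Rightarrow> 'v::ab_group_add \<Rightarrow> 'v) \<Rightarrow> (('q::field, 'k::finite) levi \<Rightarrow> 'v \<Rightarrow> 'v)
      \<Rightarrow> ('f::field, 'k) bmat \<Rightarrow> ('v \<Rightarrow> 'v) set" where
  "coeff_space smul \<sigma> \<eta> =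
     (if is_diagonal \<eta> then intertwiners smul \<sigma> \<sigma> else intertwiners smul (w_twist \<sigma>) \<sigma>)"

definition hecke_elt ::
    "('r::field \<Rightarrow> 'v::ab_group_add \<Rightarrow> 'v) \<Rightarrow> ('f::field \<Rightarrow> int) \<Rightarrow> ('f \<Rightarrow> 'q::field)
      \<Rightarrow> (('q, 'k::finite) levi \<Rightarrow> 'v \<Rightarrow> 'v) \<Rightarrow> ('f, 'k) bmat \<Rightarrow> ('v \<Rightarrow> 'v)
      \<Rightarrow> ('f, 'k) bmat \<Rightarrow> 'v \<Rightarrow> 'v" where
  "hecke_elt smul val res \<sigma> \<eta> f = (THE \<phi>. \<phi> \<in> hecke_algebra smul val res \<sigma> \<and>
     (\<forall>g. g \<notin> double_coset val \<eta> \<longrightarrow> \<phi> g = (\<lambda>_. 0)) \<and> \<phi> \<eta> = f)"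

definition hecke_elt_T ::
    "('r::field \<Rightarrow> 'v::ab_group_add \<Rightarrow> 'v) \<Rightarrow> ('f::field \<Rightarrow> int) \<Rightarrow> ('f \<Rightarrow> 'q::field)
      \<Rightarrow> (('q, 'k::finite) levi \<Rightarrow> 'v \<Rightarrow> 'v) \<Rightarrow> nat \<Rightarrow> ('f, 'k) bmat \<Rightarrow> ('v \<Rightarrow> 'v)
      \<Rightarrow> ('f, 'k) bmat \<Rightarrow> 'v \<Rightarrow> 'v" where
  "hecke_elt_T smul val res \<sigma> j \<eta> f = hecke_elt smul val res \<sigma> \<eta> ((T_star \<sigma> ^^ j) \<circ> f)"

end

theory Submission
  imports Defs
begin

text \<open>
  Write \<open>P\<close> for the parahoric subgroup. Its conjugates under the extended affine Weyl group are the groups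
  \<open>P\<^sub>n\<close> of invertible matrices which, together with their inverses, have integral diagonal blocks, upper right
  block of valuation at least \<open>n\<close> and lower left block of valuation at least \<open>1 - n\<close>. If
  \<open>\<eta> P \<eta>\<^sup>-\<^sup>1 = P\<^sub>n\<close> then \<open>\<eta>\<close> has length \<open>\<bar>n\<bar>\<close>, and this index \<open>n\<close> is a cocycle.

  When lengths add up, the indices of \<open>\<eta>\<^sup>-\<^sup>1\<close> and \<open>\<delta>\<close> have opposite signs, so the Iwahori factorisation puts
  \<open>P\<close> inside \<open>(\<eta>\<^sup>-\<^sup>1 P \<eta>) (\<delta> P \<delta>\<^sup>-\<^sup>1)\<close>. Hence \<open>P \<eta> P \<delta> P = P \<eta> \<delta> P\<close>, and since
  \<open>P \<inter> (\<eta> \<delta>) P (\<eta> \<delta>)\<^sup>-\<^sup>1\<close> is contained in \<open>\<eta> P \<eta>\<^sup>-\<^sup>1\<close> only the coset \<open>\<eta> P\<close> contributes to the value at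
  \<open>\<eta> \<delta>\<close>.

  In the quadratic case one has \<open>\<eta> = y w s\<^sup>-\<^sup>1\<close>, \<open>\<delta> = s w z\<close> and \<open>\<eta>' \<delta> = y w z\<close> with \<open>y, s, z\<close> of length zero.
  The cosets in \<open>P \<eta> P\<close> are indexed by the \<open>k \<times> k\<close> matrices over the residue field, and the product is supported
  on the double cosets of \<open>y l(C) z\<close> with \<open>l(C)\<close> lower unipotent and \<open>C\<close> integral. Modulo the maximal ideal,
  \<open>C = 0\<close> gives \<open>\<eta> \<delta>\<close>, invertible \<open>C\<close> gives \<open>\<eta>' \<delta>\<close>, and for the remaining \<open>C\<close> the values are fixed by the
  unipotent radical of a proper parabolic subgroup, so they vanish by cuspidality.
\<close>

section \<open>Matrices in block form\<close>

lemma matrix_mult_zero_left [simp]: "(0 :: 'a::semiring_1^'n^'m) ** (A :: 'a^'p^'n) = 0"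
  by (simp add: matrix_matrix_mult_def vec_eq_iff)

lemma matrix_mult_zero_right [simp]: "(A :: 'a::semiring_1^'n^'m) ** (0 :: 'a^'p^'n) = 0"
  by (simp add: matrix_matrix_mult_def vec_eq_iff)

lemma matrix_mult_add_left: "(A + B) ** C = A ** C + B ** (C :: 'a::semiring_1^'p^'n)"
  by (simp add: matrix_matrix_mult_def vec_eq_iff distrib_right sum.distrib)

lemma matrix_mult_minus_left: "(- A) ** (C :: 'a::ring_1^'p^'n) = - (A ** C)"
  by (simp add: matrix_matrix_mult_def vec_eq_iff sum_negf)

lemma matrix_mult_minus_right: "A ** (- C :: 'a::ring_1^'p^'n) = - (A ** C)"
  by (simp add: matrix_matrix_mult_def vec_eq_iff sum_negf)

lemma matrix_mult_diff_left: "(A - B) ** (C :: 'a::ring_1^'p^'n) = A ** C - B ** C"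
  by (simp add: matrix_matrix_mult_def vec_eq_iff left_diff_distrib sum_subtractf)

lemma matrix_mult_diff_right: "A ** (B - C :: 'a::ring_1^'p^'n) = A ** B - A ** C"
  by (simp add: matrix_matrix_mult_def vec_eq_iff right_diff_distrib sum_subtractf)

lemmas matrix_ring_simps = matrix_add_ldistrib matrix_mult_add_left matrix_mult_minus_left
  matrix_mult_minus_right matrix_mult_diff_left matrix_mult_diff_right matrix_mul_assoc

lemma mat_mult_nth: "(mat c ** A) $ i $ j = c * (A $ i $ j :: 'a::semiring_1)"
  by (simp add: matrix_matrix_mult_def mat_def if_distrib[of "\<lambda>x. x * _"] cong: if_cong)

lemma mult_mat_nth: "(A ** mat c) $ i $ j = (A $ i $ j :: 'a::semiring_1) * c"
  by (simp add: matrix_matrix_mult_def mat_def if_distrib[of "\<lambda>x. _ * x"] cong: if_cong)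

lemma mat_mult_mat: "(mat a :: 'a::semiring_1^'n^'n) ** mat b = mat (a * b)"
  by (simp add: vec_eq_iff mat_mult_nth) (simp add: mat_def)

lemma mat_eq_iff: "(mat a :: 'a::zero^'n^'n) = mat b \<longleftrightarrow> a = b"
  by (auto simp: vec_eq_iff mat_def)

lemma mat_eq_0_iff [simp]: "(mat a :: 'a::zero^'n^'n) = 0 \<longleftrightarrow> a = 0"
  by (auto simp: vec_eq_iff mat_def)

section \<open>Inverses and the general linear group over a field\<close>

lemma matrix_inv_unique:
  fixes A B :: "'a::field^'n^'n"
  assumes "A ** B = mat 1"
  shows "matrix_inv A = B"
proof -
  have "B ** A = mat 1"
    using assms by (simp add: matrix_left_right_inverse)
  have "\<exists>A'. A ** A' = mat 1 \<and> A' ** A = mat 1"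
    using assms \<open>B ** A = mat 1\<close> by blast
  then have "A ** matrix_inv A = mat 1"
    unfolding matrix_inv_def by (rule someI2_ex) simp
  then have "B ** (A ** matrix_inv A) = B"
    by simp
  then show ?thesis
    by (simp add: matrix_mul_assoc \<open>B ** A = mat 1\<close>)
qed

lemma GL_iff: "g \<in> GL \<longleftrightarrow> (\<exists>h. g ** h = mat 1)"
  by (simp add: GL_def invertible_right_inverse)

lemma GL_I: "g ** h = mat 1 \<Longrightarrow> g \<in> GL"
  by (auto simp: GL_iff)

lemma GL_inv_right [simp]: "g \<in> GL \<Longrightarrow> g ** matrix_inv g = mat 1"
  by (auto simp: GL_iff dest: matrix_inv_unique)

lemma GL_inv_left [simp]: "g \<in> GL \<Longrightarrow> matrix_inv g ** g = mat 1"
  using GL_inv_right matrix_left_right_inverse by blast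

lemma GL_inv [simp]: "g \<in> GL \<Longrightarrow> matrix_inv g \<in> GL"
  by (rule GL_I[OF GL_inv_left])

lemma GL_mult [simp]: "g \<in> GL \<Longrightarrow> h \<in> GL \<Longrightarrow> g ** h \<in> GL"
  by (simp add: GL_def invertible_mult)

lemma GL_one [simp]: "mat 1 \<in> GL"
  by (rule GL_I[of _ "mat 1"]) simp

lemma GL_cancel_left [simp]: "g \<in> GL \<Longrightarrow> matrix_inv g ** (g ** x) = x"
  by (simp add: matrix_mul_assoc)

lemma GL_cancel_left' [simp]: "g \<in> GL \<Longrightarrow> g ** (matrix_inv g ** x) = x"
  by (simp add: matrix_mul_assoc)

lemma GL_cancel_right [simp]: "g \<in> GL \<Longrightarrow> x ** g ** matrix_inv g = x"
  by (simp flip: matrix_mul_assoc)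

lemma GL_cancel_right' [simp]: "g \<in> GL \<Longrightarrow> x ** matrix_inv g ** g = x"
  by (simp flip: matrix_mul_assoc)

lemma inv_one [simp]: "matrix_inv (mat 1 :: 'a::field^'n^'n) = mat 1"
  by (rule matrix_inv_unique) simp

lemma inv_inv [simp]: "g \<in> GL \<Longrightarrow> matrix_inv (matrix_inv g) = g"
  by (rule matrix_inv_unique) simp

lemma inv_mult: "g \<in> GL \<Longrightarrow> h \<in> GL \<Longrightarrow> matrix_inv (g ** h) = matrix_inv h ** matrix_inv g"
  by (rule matrix_inv_unique) (simp add: matrix_mul_assoc)

lemma GL_mult_iff: "g \<in> GL \<Longrightarrow> g ** x \<in> GL \<longleftrightarrow> x \<in> GL"
  by (metis GL_cancel_left GL_inv GL_mult)

lemma GL_uminus: "g \<in> GL \<Longrightarrow> - g \<in> GL"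
  by (rule GL_I[of _ "- matrix_inv g"]) (simp add: matrix_ring_simps)

lemma inv_uminus: "g \<in> GL \<Longrightarrow> matrix_inv (- g) = - matrix_inv g"
  by (rule matrix_inv_unique) (simp add: matrix_ring_simps)

section \<open>Calculation with the four blocks of a matrix\<close>

definition ul :: "('a, 'k::finite) bmat \<Rightarrow> 'a^'k^'k" where "ul g = (\<chi> i j. g $ Inl i $ Inl j)"
definition ur :: "('a, 'k::finite) bmat \<Rightarrow> 'a^'k^'k" where "ur g = (\<chi> i j. g $ Inl i $ Inr j)"
definition ll :: "('a, 'k::finite) bmat \<Rightarrow> 'a^'k^'k" where "ll g = (\<chi> i j. g $ Inr i $ Inl j)"
definition lr :: "('a, 'k::finite) bmat \<Rightarrow> 'a^'k^'k" where "lr g = (\<chi> i j. g $ Inr i $ Inr j)"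

lemma bmat_eq_iff: "g = h \<longleftrightarrow> ul g = ul h \<and> ur g = ur h \<and> ll g = ll h \<and> lr g = lr h"
  for g h :: "('a, 'k::finite) bmat"
  by (auto simp: vec_eq_iff ul_def ur_def ll_def lr_def) (metis sum.exhaust)

lemma block_proj [simp]:
  "ul (block A B C D) = A" "ur (block A B C D) = B" "ll (block A B C D) = C" "lr (block A B C D) = D"
  by (simp_all add: vec_eq_iff ul_def ur_def ll_def lr_def block_def)

lemma block_eq_iff [simp]: "block A B C D = block A' B' C' D' \<longleftrightarrow> A = A' \<and> B = B' \<and> C = C' \<and> D = D'"
  by (simp add: bmat_eq_iff)

lemma proj_mult [simp]:
  fixes g h :: "('a::semiring_1, 'k::finite) bmat"
  shows "ul (g ** h) = ul g ** ul h + ur g ** ll h"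
    and "ur (g ** h) = ul g ** ur h + ur g ** lr h"
    and "ll (g ** h) = ll g ** ul h + lr g ** ll h"
    and "lr (g ** h) = ll g ** ur h + lr g ** lr h"
  by (simp_all add: vec_eq_iff ul_def ur_def ll_def lr_def matrix_matrix_mult_def
      sum.Plus flip: UNIV_Plus_UNIV)

lemma proj_one [simp]:
  "ul (mat 1) = (mat 1 :: 'a::semiring_1^'k::finite^'k)" "ur (mat 1) = (0 :: 'a^'k^'k)"
  "ll (mat 1) = (0 :: 'a^'k^'k)" "lr (mat 1) = (mat 1 :: 'a^'k^'k)"
  by (simp_all add: vec_eq_iff ul_def ur_def ll_def lr_def mat_def)

lemma block_mult [simp]:
  "block A B C D ** block A' B' C' D' =
     block (A ** A' + B ** C') (A ** B' + B ** D') (C ** A' + D ** C') (C ** B' + D ** (D' :: 'a::semiring_1^'k::finite^'k))"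
  by (simp add: bmat_eq_iff)

lemma block_one: "(mat 1 :: ('a::semiring_1, 'k::finite) bmat) = block (mat 1) 0 0 (mat 1)"
  by (simp add: bmat_eq_iff)

abbreviation upper_unip :: "'a::field^'k^'k \<Rightarrow> ('a, 'k::finite) bmat" where
  "upper_unip B \<equiv> block (mat 1) B 0 (mat 1)"

abbreviation lower_unip :: "'a::field^'k^'k \<Rightarrow> ('a, 'k::finite) bmat" where
  "lower_unip C \<equiv> block (mat 1) 0 C (mat 1)"

lemma GL_upper_unip [simp]: "upper_unip B \<in> GL" and inv_upper_unip [simp]: "matrix_inv (upper_unip B) = upper_unip (- B)"
proof -
  have *: "upper_unip B ** upper_unip (- B) = mat 1"
    by (simp add: block_one)
  show "upper_unip B \<in> GL" "matrix_inv (upper_unip B) = upper_unip (- B)"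
    using GL_I[OF *] matrix_inv_unique[OF *] by simp_all
qed

lemma GL_lower_unip [simp]: "lower_unip B \<in> GL" and inv_lower_unip [simp]: "matrix_inv (lower_unip B) = lower_unip (- B)"
proof -
  have *: "lower_unip B ** lower_unip (- B) = mat 1"
    by (simp add: block_one)
  show "lower_unip B \<in> GL" "matrix_inv (lower_unip B) = lower_unip (- B)"
    using GL_I[OF *] matrix_inv_unique[OF *] by simp_all
qed

section \<open>Integral matrices and reduction\<close>

text \<open>For \<open>N = 0\<close> these are the integral matrices, for \<open>N = 1\<close> those
  whose reduction vanishes. All lattice conditions below are expressed through this one
  predicate.\<close>

definition entries_ge :: "('f::field \<Rightarrow> int) \<Rightarrow> int \<Rightarrow> 'f^'n^'m \<Rightarrow> bool" where
  "entries_ge val N X \<longleftrightarrow> (\<forall>i j. val_ge val N (X $ i $ j))"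

definition res_mat :: "('f \<Rightarrow> 'q) \<Rightarrow> 'f^'n^'m \<Rightarrow> 'q^'n^'m" where
  "res_mat res X = (\<chi> i j. res (X $ i $ j))"

lemma reduction_eq: "reduction res g = (res_mat res (ul g), res_mat res (lr g))"
  by (simp add: reduction_def res_mat_def ul_def lr_def)

context nonarch_local_field
begin

section \<open>Valuation and reduction of scalars\<close>

lemma val_one [simp]: "val 1 = 0"
  using val_mult[of 1 1] by simp

lemma val_uminus [simp]: "val (- x) = val x"
proof (cases "x = 0")
  case False
  have "val (-1) = 0"
    using val_mult[of "-1" "-1"] by simp
  then show ?thesis
    using val_mult[of "-1" x] False by simp
qed simp

lemma val_ge_zero [simp]: "val_ge val N 0"
  by (simp add: val_ge_def)

lemma val_ge_one [simp]: "val_ge val 0 1"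
  by (simp add: val_ge_def)

lemma val_ge_mono: "val_ge val N x \<Longrightarrow> M \<le> N \<Longrightarrow> val_ge val M x"
  by (auto simp: val_ge_def)

lemma val_ge_add: "val_ge val N x \<Longrightarrow> val_ge val N y \<Longrightarrow> val_ge val N (x + y)"
  using val_add[of x y] by (force simp: val_ge_def)

lemma val_ge_uminus: "val_ge val N (- x) \<longleftrightarrow> val_ge val N x"
  by (simp add: val_ge_def)

lemma val_ge_mult: "val_ge val M x \<Longrightarrow> val_ge val N y \<Longrightarrow> val_ge val (M + N) (x * y)"
  using val_mult[of x y] by (cases "x = 0"; cases "y = 0") (auto simp: val_ge_def)

lemma val_ge_sum: "(\<And>i. i \<in> S \<Longrightarrow> val_ge val N (f i)) \<Longrightarrow> val_ge val N (sum f S)"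
  by (induction S rule: infinite_finite_induct) (auto intro: val_ge_add)

lemma integers_iff: "x \<in> integers val \<longleftrightarrow> val_ge val 0 x"
  by (simp add: integers_def)

lemma max_ideal_iff: "x \<in> max_ideal val \<longleftrightarrow> val_ge val 1 x"
  by (simp add: max_ideal_def)

lemma res_zero [simp]: "res 0 = 0"
  using res_kernel[of 0] by (simp add: integers_iff max_ideal_iff)

lemma res_sum: "(\<And>i. i \<in> S \<Longrightarrow> val_ge val 0 (f i)) \<Longrightarrow> res (sum f S) = (\<Sum>i\<in>S. res (f i))"
  by (induction S rule: infinite_finite_induct) (auto simp: res_add integers_iff val_ge_sum)

lemma res_prod: "(\<And>i. i \<in> S \<Longrightarrow> val_ge val 0 (f i)) \<Longrightarrow>
    val_ge val 0 (prod f S) \<and> res (prod f S) = (\<Prod>i\<in>S. res (f i))"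
proof (induction S rule: infinite_finite_induct)
  case (insert x S)
  then show ?case
    using val_ge_mult[of 0 "f x" 0 "prod f S"] by (auto simp: res_mult integers_iff)
qed (auto simp: res_one)

lemma res_uminus: "val_ge val 0 x \<Longrightarrow> res (- x) = - res x"
  using res_add[of x "- x"] by (simp add: integers_iff val_ge_uminus eq_neg_iff_add_eq_0 add.commute)

abbreviation "E \<equiv> entries_ge val"
abbreviation "R \<equiv> res_mat res"

section \<open>Entrywise bounds and reduction of matrices\<close>

lemma E_zero [simp]: "E N 0"
  by (simp add: entries_ge_def)

lemma E_one [simp]: "E 0 (mat 1)"
  by (simp add: entries_ge_def mat_def)

lemma E_mono: "E N X \<Longrightarrow> M \<le> N \<Longrightarrow> E M X"
  by (auto simp: entries_ge_def intro: val_ge_mono)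

lemma E_add: "E N X \<Longrightarrow> E N Y \<Longrightarrow> E N (X + Y)"
  by (simp add: entries_ge_def val_ge_add)

lemma E_uminus [simp]: "E N (- X) \<longleftrightarrow> E N X"
  by (simp add: entries_ge_def val_ge_uminus)

lemma E_diff: "E N X \<Longrightarrow> E N Y \<Longrightarrow> E N (X - Y)"
  using E_add[of N X "- Y"] by simp

lemma E_mult: "E M X \<Longrightarrow> E N Y \<Longrightarrow> E (M + N) (X ** Y)"
  by (simp add: entries_ge_def matrix_matrix_mult_def val_ge_sum val_ge_mult)

lemma E_mult': "E M X \<Longrightarrow> E N Y \<Longrightarrow> L \<le> M + N \<Longrightarrow> E L (X ** Y)"
  using E_mult E_mono by blast

lemma R_zero [simp]: "R 0 = 0"
  by (simp add: res_mat_def vec_eq_iff)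

lemma R_one [simp]: "R (mat 1) = mat 1"
  by (simp add: res_mat_def vec_eq_iff mat_def res_one)

lemma R_add: "E 0 X \<Longrightarrow> E 0 Y \<Longrightarrow> R (X + Y) = R X + R Y"
  by (simp add: res_mat_def vec_eq_iff entries_ge_def res_add integers_iff)

lemma R_uminus: "E 0 X \<Longrightarrow> R (- X) = - R X"
  by (simp add: res_mat_def vec_eq_iff entries_ge_def res_uminus)

lemma R_diff: "E 0 X \<Longrightarrow> E 0 Y \<Longrightarrow> R (X - Y) = R X - R Y"
  using R_add[of X "- Y"] by (simp add: R_uminus)

lemma R_mult: "E 0 X \<Longrightarrow> E 0 Y \<Longrightarrow> R (X ** Y) = R X ** R Y"
  using val_ge_mult[of 0 _ 0]
  by (simp add: res_mat_def vec_eq_iff entries_ge_def matrix_matrix_mult_def res_mult integers_iff res_sum)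

lemma R_eq_0_iff: "E 0 X \<Longrightarrow> R X = 0 \<longleftrightarrow> E 1 X"
  by (simp add: res_mat_def vec_eq_iff entries_ge_def res_kernel integers_iff max_ideal_iff)

lemma R_eq_0: "E 1 X \<Longrightarrow> R X = 0"
  using R_eq_0_iff[of X] E_mono[of 1 X 0] by simp

text \<open>A section of the reduction map obtained by choice. It need not be additive or send 0 to
  0, so lifts are compared only through \<open>R\<close>.\<close>

definition lift :: "'q^'n^'m \<Rightarrow> 'f^'n^'m" where
  "lift Y = (\<chi> i j. SOME x. val_ge val 0 x \<and> res x = Y $ i $ j)"

lemma lift_entry: "val_ge val 0 (lift Y $ i $ j) \<and> res (lift Y $ i $ j) = Y $ i $ j"
proof -
  have "\<exists>x. val_ge val 0 x \<and> res x = Y $ i $ j"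
    using res_surj by (metis UNIV_I image_iff integers_iff)
  from someI_ex[OF this] show ?thesis
    by (simp add: lift_def)
qed

lemma E_lift [simp]: "E 0 (lift Y)" and R_lift [simp]: "R (lift Y) = Y"
  by (simp_all add: entries_ge_def res_mat_def vec_eq_iff lift_entry)

text \<open>By the Leibniz formula the determinant is a polynomial in the entries with coefficients
  1 and -1, and \<open>res\<close> is a ring homomorphism on the integers.\<close>

lemma det_integral:
  assumes "E 0 (X :: 'f^'n^'n)"
  shows "val_ge val 0 (det X)" and "res (det X) = det (R X)"
proof -
  have sgn: "val_ge val 0 (of_int (sign p) :: 'f) \<and> res (of_int (sign p)) = of_int (sign p)" for p :: "'n \<Rightarrow> 'n"
    by (simp add: sign_def val_ge_uminus res_one res_uminus)
  have prd: "val_ge val 0 (\<Prod>i\<in>UNIV. X $ i $ p i) \<and>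
      res (\<Prod>i\<in>UNIV. X $ i $ p i) = (\<Prod>i\<in>UNIV. res (X $ i $ p i))" for p
    using assms by (intro res_prod) (simp add: entries_ge_def)
  have trm: "val_ge val 0 (of_int (sign p) * (\<Prod>i\<in>UNIV. X $ i $ p i))" for p
    using val_ge_mult[of 0 _ 0] sgn prd by simp
  show "val_ge val 0 (det X)"
    unfolding det_def by (intro val_ge_sum trm)
  show "res (det X) = det (R X)"
    unfolding det_def using trm sgn prd
    by (simp add: res_sum res_mult integers_iff res_mat_def)
qed

text \<open>The determinant has nonzero residue, so it is a unit, and Cramer's rule writes the
  entries of the inverse as integral determinants divided by that unit.\<close>

lemma integral_inverse:
  assumes X: "E 0 (X :: 'f^'n^'n)" and inv: "R X \<in> GL"
  shows "X \<in> GL" and "E 0 (matrix_inv X)"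
proof -
  have "det (R X) \<noteq> 0"
    using inv invertible_det_nz by (auto simp: GL_def)
  then have d: "res (det X) \<noteq> 0" "val_ge val 0 (det X)"
    using det_integral[OF X] by auto
  then have nz: "det X \<noteq> 0"
    by auto
  then show GL: "X \<in> GL"
    by (simp add: GL_def invertible_det_nz)
  have "val (det X) = 0"
    using d nz res_kernel[of "det X"] by (auto simp: integers_iff max_ideal_iff val_ge_def)
  then have vi: "val_ge val 0 (inverse (det X))"
    using val_mult[of "det X" "inverse (det X)"] nz by (simp add: val_ge_def)
  have "val_ge val 0 (matrix_inv X $ i $ j)" for i j
  proof -
    \<comment> \<open>The \<open>j\<close>-th column of the inverse solves a linear system, to which
      Cramer's rule applies.\<close>
    have "X *v (matrix_inv X *v axis j 1) = axis j 1"
      by (simp add: matrix_vector_mul_assoc GL)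
    then have "matrix_inv X *v axis j 1 =
        (\<chi> k. det (\<chi> i j'. if j' = k then axis j 1 $ i else X $ i $ j') / det X)"
      by (simp add: cramer[OF nz])
    moreover have "(matrix_inv X *v axis j 1) $ i = matrix_inv X $ i $ j"
      by (simp add: matrix_vector_mult_def axis_def if_distrib[of "\<lambda>x. _ * x"] cong: if_cong)
    ultimately have *: "matrix_inv X $ i $ j =
        det (\<chi> i' j'. if j' = i then axis j 1 $ i' else X $ i' $ j') * inverse (det X)"
      by (simp add: divide_inverse)
    have "E 0 (\<chi> i' j'. if j' = i then axis j 1 $ i' else X $ i' $ j')"
      using X by (simp add: entries_ge_def axis_def)
    from val_ge_mult[OF det_integral(1)[OF this] vi] show ?thesis
      by (simp add: *)
  qed
  then show "E 0 (matrix_inv X)"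
    by (simp add: entries_ge_def)
qed

end

section \<open>The parahoric subgroup and its conjugates\<close>

context nonarch_local_field
begin

section \<open>The parahoric subgroup, its conjugates and its reductive quotient\<close>

definition blocks_ge :: "int \<Rightarrow> ('f, 'k::finite) bmat \<Rightarrow> bool" where
  "blocks_ge n g \<longleftrightarrow> E 0 (ul g) \<and> E n (ur g) \<and> E (1 - n) (ll g) \<and> E 0 (lr g)"

definition PG :: "int \<Rightarrow> ('f, 'k::finite) bmat set" where
  "PG n = {g \<in> GL. blocks_ge n g \<and> blocks_ge n (matrix_inv g)}"

text \<open>The two off-diagonal bounds \<open>n\<close> and \<open>1 - n\<close> add up to 1, so an
  upper right block times a lower left block is integral.\<close>

lemma blocks_ge_mult: "blocks_ge n g \<Longrightarrow> blocks_ge n h \<Longrightarrow> blocks_ge n (g ** h)"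
  by (auto simp: blocks_ge_def intro!: E_add elim: E_mult')

lemma PG_GL: "g \<in> PG n \<Longrightarrow> g \<in> GL"
  by (simp add: PG_def)

lemma PG_blocks_ge: "g \<in> PG n \<Longrightarrow> blocks_ge n g"
  by (simp add: PG_def)

lemma PG_mult: "g \<in> PG n \<Longrightarrow> h \<in> PG n \<Longrightarrow> g ** h \<in> PG n"
  by (simp add: PG_def blocks_ge_mult inv_mult)

lemma PG_inv: "g \<in> PG n \<Longrightarrow> matrix_inv g \<in> PG n"
  by (simp add: PG_def)

lemma PG_one: "mat 1 \<in> PG n"
  by (simp add: PG_def blocks_ge_def)

lemma PG_mult_iff': "g \<in> PG n \<Longrightarrow> x ** g \<in> PG n \<longleftrightarrow> x \<in> PG n"
  by (metis PG_GL PG_inv PG_mult GL_cancel_right)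

lemma upper_unip_PG: "E n B \<Longrightarrow> upper_unip B \<in> PG n"
  by (simp add: PG_def blocks_ge_def)

lemma lower_unip_PG: "lower_unip C \<in> PG n \<longleftrightarrow> E (1 - n) C"
  by (simp add: PG_def blocks_ge_def)

text \<open>The mixed term \<open>ll g ** ur h\<close> has valuation at least 1 and disappears under
  reduction.\<close>

lemma R_lr_mult: "blocks_ge 0 g \<Longrightarrow> blocks_ge 0 h \<Longrightarrow> R (lr (g ** h)) = R (lr g) ** R (lr h)"
  using E_mult[of 1 "ll g" 0 "ur h"] E_mult[of 0 "lr g" 0 "lr h"] E_mono[of 1 "ll g ** ur h" 0]
  by (simp add: blocks_ge_def R_add R_mult R_eq_0)

lemma R_ul_mult: "blocks_ge 0 g \<Longrightarrow> blocks_ge 0 h \<Longrightarrow> R (ul (g ** h)) = R (ul g) ** R (ul h)"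
  using E_mult[of 0 "ur g" 1 "ll h"] E_mult[of 0 "ul g" 0 "ul h"] E_mono[of 1 "ur g ** ll h" 0]
  by (simp add: blocks_ge_def R_add R_mult R_eq_0)

text \<open>The point is that the inverse also has its lower left block in the maximal ideal: modulo
  that ideal the matrix is block upper triangular with invertible diagonal blocks.\<close>

lemma parahoric_eq: "parahoric val = (PG 0 :: ('f, 'k::finite) bmat set)"
proof (intro set_eqI iffI)
  fix g :: "('f, 'k) bmat"
  assume "g \<in> PG 0"
  then have g: "g \<in> GL" "blocks_ge 0 g" "blocks_ge 0 (matrix_inv g)"
    by (auto simp: PG_def)
  have int: "h $ i $ j \<in> integers val" if "blocks_ge 0 h" for h :: "('f, 'k) bmat" and i j
    using that val_ge_mono[of 1 _ 0]
    by (cases i; cases j) (simp_all add: blocks_ge_def entries_ge_def ul_def ur_def ll_def lr_def integers_iff)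
  show "g \<in> parahoric val"
    using g int by (auto simp: parahoric_def GL_integers_def max_ideal_iff blocks_ge_def entries_ge_def ll_def)
next
  fix g :: "('f, 'k) bmat"
  assume "g \<in> parahoric val"
  then have GL: "g \<in> GL" and int: "\<And>i j. val_ge val 0 (g $ i $ j)" "\<And>i j. val_ge val 0 (matrix_inv g $ i $ j)"
      and ll: "\<And>i j. val_ge val 1 (g $ Inr i $ Inl j)"
    by (auto simp: parahoric_def GL_integers_def integers_iff max_ideal_iff)
  define h where "h = matrix_inv g"
  have g: "E 0 (ul g)" "E 0 (ur g)" "E 1 (ll g)" "E 0 (lr g)"
    and h: "E 0 (ul h)" "E 0 (ur h)" "E 0 (ll h)" "E 0 (lr h)"
    using int ll by (auto simp: h_def entries_ge_def ul_def ur_def ll_def lr_def)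
  have "g ** h = mat 1"
    using GL by (simp add: h_def)
  then have eq: "ll g ** ul h + lr g ** ll h = 0" "ll g ** ur h + lr g ** lr h = mat 1"
    by (simp_all add: bmat_eq_iff)
  have p: "R (ll g ** X) = 0" "E 0 (ll g ** X)" "E 0 (lr g ** X)" if "E 0 X" for X :: "'f^'k^'k"
    using E_mult[OF g(3) that] E_mult[OF g(4) that] E_mono[of 1 _ 0] by (auto simp: R_eq_0)
  have "R (lr g) ** R (lr h) = mat 1"
    using arg_cong[OF eq(2), of R] g h p by (simp add: R_add R_mult)
  then have GLd: "R (lr g) \<in> GL"
    by (rule GL_I)
  \<comment> \<open>Reducing the lower left block of \<open>g ** h = mat 1\<close> kills the term
    with \<open>ll g\<close>; the invertible factor \<open>R (lr g)\<close> can then be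
    cancelled.\<close>
  have "R (lr g) ** R (ll h) = 0"
    using arg_cong[OF eq(1), of R] g h p by (simp add: R_add R_mult)
  then have "R (ll h) = 0"
    by (metis GLd GL_cancel_left matrix_mult_zero_right)
  then have "E 1 (ll h)"
    using h R_eq_0_iff by blast
  then show "g \<in> PG 0"
    using GL g h by (simp add: PG_def blocks_ge_def h_def)
qed

lemma PG_zero_blocks_GL:
  assumes "g \<in> PG 0"
  shows "R (ul g) \<in> GL" "R (lr g) \<in> GL"
proof -
  have "g ** matrix_inv g = mat 1" "blocks_ge 0 g" "blocks_ge 0 (matrix_inv g)"
    using assms by (auto simp: PG_def)
  then have "R (ul g) ** R (ul (matrix_inv g)) = mat 1" "R (lr g) ** R (lr (matrix_inv g)) = mat 1"
    using R_ul_mult[of g "matrix_inv g"] R_lr_mult[of g "matrix_inv g"]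
    by (simp_all del: proj_mult)
  then show "R (ul g) \<in> GL" "R (lr g) \<in> GL"
    by (auto intro: GL_I)
qed

lemma reduction_Levi: "g \<in> PG 0 \<Longrightarrow> reduction res g \<in> Levi"
  by (simp add: reduction_eq Levi_def PG_zero_blocks_GL)

lemma reduction_mult:
  assumes "g \<in> PG 0" "h \<in> PG 0"
  shows "reduction res (g ** h) =
    (fst (reduction res g) ** fst (reduction res h), snd (reduction res g) ** snd (reduction res h))"
  using R_ul_mult[OF PG_blocks_ge PG_blocks_ge, OF assms] R_lr_mult[OF PG_blocks_ge PG_blocks_ge, OF assms] by (simp add: reduction_eq)

text \<open>The bound on the upper right block is vacuous for \<open>g\<close> and for its inverse,
  and for \<open>n \<ge> 0\<close> the bound \<open>1 - n\<close> on the lower left block is weaker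
  than 1.\<close>

lemma PG_zero_ur_zero:
  assumes "g \<in> PG 0" "ur g = 0" "0 \<le> n"
  shows "g \<in> PG n" and "ur (matrix_inv g) = 0"
proof -
  have "ul g \<in> GL"
    using assms(1) integral_inverse(1)[of "ul g"] PG_zero_blocks_GL by (auto simp: PG_def blocks_ge_def)
  moreover have "ul g ** ur (matrix_inv g) = 0"
    using arg_cong[OF GL_inv_right[OF PG_GL[OF assms(1)]], of ur] assms by simp
  ultimately show *: "ur (matrix_inv g) = 0"
    by (metis GL_cancel_left matrix_mult_zero_right)
  show "g \<in> PG n"
    using assms * by (auto simp: PG_def blocks_ge_def elim: E_mono)
qed

lemma PG_zero_ll_zero:
  assumes "g \<in> PG 0" "ll g = 0" "n \<le> 0"
  shows "g \<in> PG n"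
proof -
  have "lr g \<in> GL"
    using assms(1) integral_inverse(1)[of "lr g"] PG_zero_blocks_GL by (auto simp: PG_def blocks_ge_def)
  moreover have "lr g ** ll (matrix_inv g) = 0"
    using arg_cong[OF GL_inv_right[OF PG_GL[OF assms(1)]], of ll] assms by simp
  ultimately have *: "ll (matrix_inv g) = 0"
    by (metis GL_cancel_left matrix_mult_zero_right)
  show "g \<in> PG n"
    using assms * by (auto simp: PG_def blocks_ge_def elim: E_mono)
qed

text \<open>Block elimination: the lower right block has an integral inverse, so a row operation
  with integral coefficients clears the upper right block.\<close>

lemma PG_zero_factor_upper:
  assumes g: "g \<in> PG 0"
  obtains B q where "g = upper_unip B ** q" "E 0 B" "q \<in> PG 0" "ur q = 0"
proof -
  have E: "E 0 (ur g)" "E 0 (lr g)"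
    using g by (auto simp: PG_def blocks_ge_def)
  have i: "lr g \<in> GL" "E 0 (matrix_inv (lr g))"
    using integral_inverse[OF E(2)] PG_zero_blocks_GL[OF g] by auto
  define B where "B = ur g ** matrix_inv (lr g)"
  have B: "E 0 B"
    using E_mult[OF E(1) i(2)] by (simp add: B_def)
  show thesis
  proof (rule that)
    show "g = upper_unip B ** (upper_unip (- B) ** g)"
      using GL_cancel_left'[OF GL_upper_unip, of B g] by simp
    show "upper_unip (- B) ** g \<in> PG 0"
      using B g by (intro PG_mult upper_unip_PG) auto
    show "ur (upper_unip (- B) ** g) = 0"
      using i by (simp add: B_def matrix_ring_simps)
  qed (rule B)
qed

text \<open>Mirror image of the previous elimination, now with the upper left block as pivot; the
  coefficients lie in the maximal ideal.\<close>

lemma PG_zero_factor_lower: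
  assumes g: "g \<in> PG 0"
  obtains C q where "g = lower_unip C ** q" "E 1 C" "q \<in> PG 0" "ll q = 0"
proof -
  have E: "E 1 (ll g)" "E 0 (ul g)"
    using g by (auto simp: PG_def blocks_ge_def)
  have i: "ul g \<in> GL" "E 0 (matrix_inv (ul g))"
    using integral_inverse[OF E(2)] PG_zero_blocks_GL[OF g] by auto
  define C where "C = ll g ** matrix_inv (ul g)"
  have C: "E 1 C"
    using E_mult[OF E(1) i(2)] by (simp add: C_def)
  show thesis
  proof (rule that)
    show "g = lower_unip C ** (lower_unip (- C) ** g)"
      using GL_cancel_left'[OF GL_lower_unip, of C g] by simp
    show "lower_unip (- C) ** g \<in> PG 0"
      using C g by (intro PG_mult) (auto simp: lower_unip_PG)
    show "ll (lower_unip (- C) ** g) = 0"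
      using i by (simp add: C_def matrix_ring_simps)
  qed (rule C)
qed

text \<open>The Iwahori factorisation of the parahoric subgroup, with the three factors distributed over two
  conjugates.\<close>

lemma PG_zero_factor:
  assumes g: "g \<in> PG 0" and mn: "m \<le> 0 \<and> 0 \<le> n \<or> n \<le> 0 \<and> 0 \<le> m"
  obtains x y where "x \<in> PG 0" "x \<in> PG m" "y \<in> PG n" "g = x ** y"
  using mn
proof
  assume "m \<le> 0 \<and> 0 \<le> n"
  moreover obtain B q where "g = upper_unip B ** q" "E 0 B" "q \<in> PG 0" "ur q = 0"
    using PG_zero_factor_upper[OF g] .
  ultimately show thesis
    using that[of "upper_unip B" q] PG_zero_ur_zero(1)[of q n] E_mono[of 0 B m] by (simp add: upper_unip_PG)
next
  assume "n \<le> 0 \<and> 0 \<le> m"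
  moreover obtain C q where C: "g = lower_unip C ** q" "E 1 C" "q \<in> PG 0" "ll q = 0"
    using PG_zero_factor_lower[OF g] .
  ultimately show thesis
    using that[of "lower_unip C" q] PG_zero_ll_zero[of q n] E_mono[of 1 C "1 - m"] by (simp add: lower_unip_PG)
qed

text \<open>The bounds of index 0 and \<open>c\<close> together give \<open>max 0 c\<close> for the
  upper right block and \<open>1 - min 0 c\<close> for the lower left one, and these dominate
  \<open>b\<close> and \<open>1 - b\<close>.\<close>

lemma PG_zero_between:
  assumes "g \<in> PG 0" "g \<in> PG c" "min 0 c \<le> b" "b \<le> max 0 c"
  shows "g \<in> PG b"
proof -
  have *: "E b X" if "E 0 X" "E c X" for X :: "'f^'k^'k"
    using that assms(4) E_mono[of 0 X b] E_mono[of c X b] by linarith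
  have **: "E (1 - b) X" if "E 1 X" "E (1 - c) X" for X :: "'f^'k^'k"
    using that assms(3) E_mono[of 1 X "1 - b"] E_mono[of "1 - c" X "1 - b"] by linarith
  show ?thesis
    using assms(1,2) * ** by (auto simp: PG_def blocks_ge_def)
qed

end

section \<open>The extended affine Weyl group\<close>

text \<open>A normal form for the elements of \<open>Weyl \<pi>\<close>; the flag \<open>d\<close>
  separates the diagonal elements from the antidiagonal ones.\<close>

definition weyl_elt :: "'f::field \<Rightarrow> bool \<Rightarrow> int \<Rightarrow> int \<Rightarrow> ('f, 'k::finite) bmat" where
  "weyl_elt \<pi> d a b = (if d then block (mat (\<pi> powi a)) 0 0 (mat (\<pi> powi b))
                   else block 0 (mat (\<pi> powi a)) (mat (\<pi> powi b)) 0)"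

text \<open>Conjugation by \<open>weyl_elt \<pi> d a b\<close> maps the parahoric subgroup onto the conjugate of index
  \<open>offset d a b\<close>, so that the length of \<open>weyl_elt \<pi> d a b\<close> is the absolute value of its offset.\<close>

definition offset :: "bool \<Rightarrow> int \<Rightarrow> int \<Rightarrow> int" where
  "offset d a b = (if d then a - b else 1 + a - b)"

locale local_field_uniformizer = nonarch_local_field val res
  for val :: "'f::field \<Rightarrow> int" and res :: "'f \<Rightarrow> 'q::{field,finite}" +
  fixes \<pi> :: 'f
  assumes uniformizer: "uniformizer val \<pi>"
begin

abbreviation "W \<equiv> weyl_elt \<pi>"

lemma pi_nonzero [simp]: "\<pi> \<noteq> 0" and val_pi [simp]: "val \<pi> = 1"
  using uniformizer by (auto simp: uniformizer_def)

lemma val_pi_pow: "val (\<pi> ^ n) = int n"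
  by (induction n) (simp_all add: val_mult)

lemma val_pi_powi [simp]: "val (\<pi> powi a) = a"
proof (cases "a \<ge> 0")
  case True
  then show ?thesis
    by (simp add: power_int_def val_pi_pow)
next
  case False
  have "val (\<pi> powi a) + val (\<pi> powi (- a)) = 0"
    using val_mult[of "\<pi> powi a" "\<pi> powi (- a)"] by (simp flip: power_int_add)
  moreover have "val (\<pi> powi (- a)) = - a"
    using False by (simp add: power_int_def val_pi_pow)
  ultimately show ?thesis
    by simp
qed

lemma pi_powi_eq_iff [simp]: "\<pi> powi a = \<pi> powi b \<longleftrightarrow> a = b"
  using val_pi_powi by metis

lemma E_pi_powi: "E n X \<Longrightarrow> E (n + c) (mat (\<pi> powi c) ** X)"
  using val_ge_mult[of c "\<pi> powi c" n]
  by (simp add: entries_ge_def mat_mult_nth add.commute) (simp add: val_ge_def)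

lemma W_mult:
  "W True a b ** W d a' b' = W d (a + a') (b + b')"
  "W False a b ** W d a' b' = W (\<not> d) (a + b') (b + a')"
  by (simp_all add: weyl_elt_def mat_mult_mat power_int_add)

lemma W_one: "mat 1 = W True 0 0"
  by (simp add: weyl_elt_def block_one)

lemma W_inv: "matrix_inv (W d a b) = (if d then W True (- a) (- b) else W False (- b) (- a))"
  by (rule matrix_inv_unique) (cases d; simp add: W_mult W_one)

lemma W_GL [simp]: "W d a b \<in> GL"
proof -
  have "W d a b ** (if d then W True (- a) (- b) else W False (- b) (- a)) = mat 1"
    by (cases d) (simp_all add: W_mult W_one)
  then show ?thesis
    by (rule GL_I)
qed

lemma W_inject [simp]: "W d a b = W d' a' b' \<longleftrightarrow> d = d' \<and> a = a' \<and> b = b'"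
  by (auto simp: weyl_elt_def mat_eq_iff)

lemma W_simps: "block_diag \<pi> a b = W True a b" "w_mat = W False 0 0" "t_mat \<pi> = W False 0 1"
  by (simp_all add: block_diag_def weyl_elt_def w_mat_def t_mat_def)

lemma w'_eq: "w'_mat \<pi> = W False (- 1) 1"
  by (simp add: w'_mat_def W_simps W_inv W_mult)

lemma W_mult_ex: "\<exists>a'' b''. W d a b ** W d' a' b' = W (d = d') a'' b''"
  by (cases d) (auto simp: W_mult)

lemma Weyl_cases: assumes "\<eta> \<in> Weyl \<pi>" obtains d a b where "\<eta> = W d a b"
proof -
  from assms have "\<exists>d a b. \<eta> = W d a b"
  proof induction
    case (mult x y)
    then obtain d a b d' a' b' where "x = W d a b" "y = W d' a' b'"
      by blast
    then show ?case
      using W_mult_ex by metis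
  next
    case (inv x)
    then show ?case
      using W_inv by metis
  qed (use W_simps in blast)+
  with that show thesis
    by blast
qed

lemma is_diagonal_W: "is_diagonal (W d a b :: ('f, 'k::finite) bmat) \<longleftrightarrow> d"
proof
  assume *: "is_diagonal (W d a b :: ('f, 'k) bmat)"
  \<comment> \<open>Types are inhabited, so the upper right block has a diagonal entry; for an
    antidiagonal element it is a power of \<pi>, hence nonzero.\<close>
  fix i :: 'k
  have "W d a b $ Inl i $ Inr i = (0 :: 'f)"
    using * by (simp add: is_diagonal_def)
  then show d
    by (simp add: weyl_elt_def block_def mat_def split: if_splits)
qed (auto simp: is_diagonal_def weyl_elt_def block_def mat_def split: sum.splits)

lemma W_conj:
  "W d a b ** g ** matrix_inv (W d a b) =
    (if d then block (ul g) (mat (\<pi> powi (a - b)) ** ur g) (mat (\<pi> powi (b - a)) ** ll g) (lr g)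
     else block (lr g) (mat (\<pi> powi (a - b)) ** ll g) (mat (\<pi> powi (b - a)) ** ur g) (ul g))"
  (is "_ = ?c")
proof -
  have [simp]: "\<pi> powi (x - y) * z * \<pi> powi y = \<pi> powi x * z" for x y z
    by (simp add: power_int_diff)
  have "W d a b ** g = ?c ** W d a b"
    by (auto simp: bmat_eq_iff weyl_elt_def vec_eq_iff mat_mult_nth mult_mat_nth)
  then show ?thesis
    by simp
qed

text \<open>An antidiagonal element exchanges the off-diagonal blocks, so the bound
  \<open>1 - n\<close> of the lower left block becomes \<open>1 - n + (a - b)\<close> for the upper
  right one. This explains the sign and the summand 1 in \<open>offset\<close>.\<close>

lemma blocks_ge_conj:
  assumes "blocks_ge n g"
  shows "blocks_ge (offset d a b + (if d then n else - n)) (W d a b ** g ** matrix_inv (W d a b))"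
  using assms E_pi_powi[of n "ur g" "a - b"] E_pi_powi[of "1 - n" "ll g" "b - a"]
    E_pi_powi[of n "ur g" "b - a"] E_pi_powi[of "1 - n" "ll g" "a - b"]
  by (auto simp: blocks_ge_def W_conj offset_def algebra_simps)

lemma PG_conj:
  assumes "g \<in> PG n"
  shows "W d a b ** g ** matrix_inv (W d a b) \<in> PG (offset d a b + (if d then n else - n))"
  using assms blocks_ge_conj[of n g d a b] blocks_ge_conj[of n "matrix_inv g" d a b]
  by (simp add: PG_def inv_mult matrix_mul_assoc)

lemma PG_conj_inv:
  assumes "g \<in> PG (offset d a b + (if d then n else - n))"
  shows "matrix_inv (W d a b) ** g ** W d a b \<in> PG n"
proof (cases d)
  case True
  then show ?thesis
    using PG_conj[OF assms, of True "- a" "- b"] W_inv[of True "- a" "- b"]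
    by (simp add: W_inv offset_def)
next
  case False
  then show ?thesis
    using PG_conj[OF assms, of False "- b" "- a"] W_inv[of False "- b" "- a"]
    by (simp add: W_inv offset_def)
qed

lemma PG_zero_conj: "g \<in> PG 0 \<Longrightarrow> W d a b ** g ** matrix_inv (W d a b) \<in> PG (offset d a b)"
  using PG_conj[of g 0 d a b] by (cases d) simp_all

lemma PG_zero_conj_inv: "g \<in> PG (offset d a b) \<Longrightarrow> matrix_inv (W d a b) ** g ** W d a b \<in> PG 0"
  using PG_conj_inv[of g d a b 0] by (cases d) simp_all

text \<open>The powers of \<pi> cancel on the diagonal blocks, so only the exchange of the two Levi
  factors remains visible.\<close>

lemma reduction_conj:
  "reduction res (W d a b ** g ** matrix_inv (W d a b)) =
     (if d then reduction res g else prod.swap (reduction res g))"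
  by (simp add: W_conj reduction_eq)

text \<open>The cocycle rule: conjugation by the second factor comes first, and the first factor
  then shifts the index, reversing its sign if antidiagonal.\<close>

lemma offset_mult:
  "W d a b ** W d' a' b' = W d'' a'' b'' \<Longrightarrow>
     offset d'' a'' b'' = offset d a b + (if d then offset d' a' b' else - offset d' a' b')"
  by (cases d) (auto simp: W_mult offset_def)

text \<open>The square of \<open>t_mat \<pi>\<close> is the scalar matrix \<pi>, so a power is
  determined by its parity and a scalar; \<open>div\<close> rounds down, which also covers negative
  exponents.\<close>

lemma t_pow: "mat_powi (t_mat \<pi>) i = W (even i) (i div 2) ((i + 1) div 2)"
proof -
  have pos: "((**) (W False 0 1) ^^ n) (mat 1) = W (even n) (int n div 2) ((int n + 1) div 2)" for n
    by (induction n) (auto simp: W_one W_mult)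
  have neg: "((**) (W False (- 1) 0) ^^ n) (mat 1) = W (even n) ((- int n) div 2) ((- int n + 1) div 2)" for n
    by (induction n) (auto simp: W_one W_mult)
  show ?thesis
  proof (cases "0 \<le> i")
    case True
    then show ?thesis
      using pos[of "nat i"] by (simp add: mat_powi_def W_simps even_nat_iff)
  next
    case False
    then show ?thesis
      using neg[of "nat (- i)"] by (simp add: mat_powi_def W_simps W_inv even_nat_iff add.commute)
  qed
qed

text \<open>Powers of \<open>t_mat \<pi>\<close> have offset 0 and the simple reflections have
  offset 1 and -1, so by the cocycle rule each letter changes the absolute value by at most 1. This
  bounds the length from below.\<close>

lemma word_offset:
  assumes "set ss \<subseteq> simple_refls \<pi>"
  shows "\<exists>d a b. foldr (**) ss (mat_powi (t_mat \<pi>) i) = W d a b \<and> \<bar>offset d a b\<bar> \<le> int (length ss)"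
  using assms
proof (induction ss)
  case Nil
  have "offset (even i) (i div 2) ((i + 1) div 2) = 0"
    by (auto simp: offset_def elim!: evenE oddE)
  then show ?case
    by (force simp: t_pow)
next
  case (Cons s ss)
  then obtain d a b where *: "foldr (**) ss (mat_powi (t_mat \<pi>) i) = W d a b"
      "\<bar>offset d a b\<bar> \<le> int (length ss)"
    by auto
  obtain a' b' where s: "s = W False a' b'" "\<bar>offset False a' b'\<bar> = 1"
    using Cons.prems by (auto simp: simple_refls_def W_simps w'_eq offset_def)
  have "foldr (**) (s # ss) (mat_powi (t_mat \<pi>) i) = W (\<not> d) (a' + b) (b' + a)"
    by (simp add: * s W_mult)
  moreover have "\<bar>offset (\<not> d) (a' + b) (b' + a)\<bar> \<le> int (length (s # ss))"
    using * s by (auto simp: offset_def split: if_splits)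
  ultimately show ?case
    by blast
qed

text \<open>Descent on the offset: left multiplication by \<open>w_mat\<close> when it is positive,
  by \<open>w'_mat \<pi>\<close> when it is negative, lowers its absolute value by 1. This bounds
  the length from above.\<close>

lemma W_word:
  "\<exists>ss i. length ss = nat \<bar>offset d a b\<bar> \<and> set ss \<subseteq> simple_refls \<pi> \<and>
     (W d a b :: ('f, 'k::finite) bmat) = foldr (**) ss (mat_powi (t_mat \<pi>) i)"
proof (induction "nat \<bar>offset d a b\<bar>" arbitrary: d a b rule: less_induct)
  case less
  consider "offset d a b = 0" | "offset d a b > 0" | "offset d a b < 0"
    by linarith
  then show ?case
  proof cases
    case 1
    \<comment> \<open>Offset 0 forces \<open>b = a\<close> in the diagonal case and
      \<open>b = a + 1\<close> in the antidiagonal case, which are the even and the odd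
      powers.\<close>
    then have "W d a b = mat_powi (t_mat \<pi>) (a + b)"
      by (auto simp: t_pow offset_def split: if_splits)
    then show ?thesis
      using 1 by (intro exI[of _ "[]"]) auto
  next
    case 2
    have o: "offset (\<not> d) b a = 1 - offset d a b"
      by (simp add: offset_def)
    then obtain ss i where ss: "length ss = nat \<bar>offset (\<not> d) b a\<bar>" "set ss \<subseteq> simple_refls \<pi>"
        "(W (\<not> d) b a :: ('f, 'k) bmat) = foldr (**) ss (mat_powi (t_mat \<pi>) i)"
      using less[of "\<not> d" b a] 2 by auto
    have "(W d a b :: ('f, 'k) bmat) = W False 0 0 ** W (\<not> d) b a"
      by (simp add: W_mult)
    then have "(W d a b :: ('f, 'k) bmat) = foldr (**) (w_mat # ss) (mat_powi (t_mat \<pi>) i)"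
      by (simp add: ss W_simps(2))
    moreover have "length (w_mat # ss) = nat \<bar>offset d a b\<bar>"
      using ss o 2 by simp
    moreover have "set (w_mat # ss) \<subseteq> simple_refls \<pi>"
      using ss by (simp add: simple_refls_def)
    ultimately show ?thesis
      by metis
  next
    case 3
    have o: "offset (\<not> d) (b - 1) (a + 1) = - 1 - offset d a b"
      by (simp add: offset_def)
    then obtain ss i where ss: "length ss = nat \<bar>offset (\<not> d) (b - 1) (a + 1)\<bar>" "set ss \<subseteq> simple_refls \<pi>"
        "(W (\<not> d) (b - 1) (a + 1) :: ('f, 'k) bmat) = foldr (**) ss (mat_powi (t_mat \<pi>) i)"
      using less[of "\<not> d" "b - 1" "a + 1"] 3 by auto
    have "(W d a b :: ('f, 'k) bmat) = W False (- 1) 1 ** W (\<not> d) (b - 1) (a + 1)"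
      by (simp add: W_mult)
    then have "(W d a b :: ('f, 'k) bmat) = foldr (**) (w'_mat \<pi> # ss) (mat_powi (t_mat \<pi>) i)"
      by (simp add: ss w'_eq)
    moreover have "length (w'_mat \<pi> # ss) = nat \<bar>offset d a b\<bar>"
      using ss o 3 by simp
    moreover have "set (w'_mat \<pi> # ss) \<subseteq> simple_refls \<pi>"
      using ss by (simp add: simple_refls_def)
    ultimately show ?thesis
      by metis
  qed
qed

lemma len_W: "len \<pi> (W d a b :: ('f, 'k::finite) bmat) = nat \<bar>offset d a b\<bar>"
  unfolding len_def
proof (rule Least_equality)
  show "\<exists>ss i. length ss = nat \<bar>offset d a b\<bar> \<and> set ss \<subseteq> simple_refls \<pi> \<and>
     (W d a b :: ('f, 'k) bmat) = foldr (**) ss (mat_powi (t_mat \<pi>) i)"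
    by (rule W_word)
next
  fix r
  assume "\<exists>ss i. length ss = r \<and> set ss \<subseteq> simple_refls \<pi> \<and>
     (W d a b :: ('f, 'k) bmat) = foldr (**) ss (mat_powi (t_mat \<pi>) i)"
  then obtain ss i where "length ss = r" "set ss \<subseteq> simple_refls \<pi>"
     "(W d a b :: ('f, 'k) bmat) = foldr (**) ss (mat_powi (t_mat \<pi>) i)"
    by blast
  with word_offset[of ss i] show "nat \<bar>offset d a b\<bar> \<le> r"
    by auto
qed

end

section \<open>Cosets of the parahoric subgroup\<close>

context local_field_uniformizer
begin

abbreviation P :: "('f, 'k::finite) bmat set" where "P \<equiv> PG 0"

section \<open>Left cosets and double cosets of the parahoric subgroup\<close>

definition coset :: "('f, 'k::finite) bmat \<Rightarrow> ('f, 'k) bmat set" where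
  "coset h = (**) h ` P"

lemma mem_coset_iff: "h \<in> GL \<Longrightarrow> x \<in> coset h \<longleftrightarrow> matrix_inv h ** x \<in> P"
  by (auto simp: coset_def intro: image_eqI[of _ _ "matrix_inv h ** x"])

lemma coset_self: "h \<in> coset h"
  using PG_one[of 0] by (force simp: coset_def)

lemma coset_mult:
  fixes h :: "('f, 'k::finite) bmat"
  assumes p: "p \<in> P"
  shows "coset (h ** p) = coset h"
proof -
  have "(**) p ` P = P"
  proof (intro equalityI subsetI)
    fix x :: "('f, 'k) bmat" assume "x \<in> P"
    then have "matrix_inv p ** x \<in> P"
      using p by (simp add: PG_inv PG_mult)
    then show "x \<in> (**) p ` P"
      using p by (intro image_eqI[of _ _ "matrix_inv p ** x"]) (simp_all add: PG_GL)
  qed (use p PG_mult in blast)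
  then have "(**) h ` (**) p ` P = (**) h ` P"
    by simp
  then show ?thesis
    by (simp add: coset_def image_image matrix_mul_assoc)
qed

lemma coset_eqI: "x \<in> coset h \<Longrightarrow> coset x = coset h"
  by (auto simp: coset_mult coset_def[of h])

lemma coset_translate: "coset (x ** h) = (**) x ` coset h"
  by (simp add: coset_def image_image matrix_mul_assoc)

lemma double_coset_eq: "double_coset val g = {p ** g ** q | p q. p \<in> P \<and> q \<in> P}"
  by (simp add: double_coset_def parahoric_eq)

abbreviation "DC \<equiv> double_coset val"

lemma DC_I: "p \<in> P \<Longrightarrow> q \<in> P \<Longrightarrow> p ** g ** q \<in> DC g"
  by (auto simp: double_coset_eq)

lemma DC_self: "g \<in> DC g"
  using DC_I[OF PG_one PG_one, of g] by simp

lemma DC_GL: "x \<in> DC g \<Longrightarrow> g \<in> GL \<Longrightarrow> x \<in> GL"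
  by (auto simp: double_coset_eq PG_GL)

lemma DC_mult: "x \<in> DC g \<Longrightarrow> p \<in> P \<Longrightarrow> q \<in> P \<Longrightarrow> p ** x ** q \<in> DC g"
proof -
  assume "x \<in> DC g" and pq: "p \<in> P" "q \<in> P"
  then obtain p' q' where x: "p' \<in> P" "q' \<in> P" "x = p' ** g ** q'"
    by (auto simp: double_coset_eq)
  then have "p ** x ** q = (p ** p') ** g ** (q' ** q)"
    by (simp add: matrix_mul_assoc)
  then show ?thesis
    using DC_I[OF PG_mult[OF pq(1) x(1)] PG_mult[OF x(2) pq(2)]] by simp
qed

lemma DC_mult_left: "x \<in> DC g \<Longrightarrow> p \<in> P \<Longrightarrow> p ** x \<in> DC g"
  using DC_mult[of x g p "mat 1"] by (simp add: PG_one)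

lemma DC_sym: "x \<in> DC g \<Longrightarrow> g \<in> DC x"
proof -
  assume "x \<in> DC g"
  then obtain p q where x: "p \<in> P" "q \<in> P" "x = p ** g ** q"
    by (auto simp: double_coset_eq)
  then have "matrix_inv p ** x ** matrix_inv q = matrix_inv p ** p ** g ** (q ** matrix_inv q)"
    by (simp only: matrix_mul_assoc)
  then have "g = matrix_inv p ** x ** matrix_inv q"
    using x by (simp add: PG_GL)
  then show ?thesis
    using DC_I[OF PG_inv[OF x(1)] PG_inv[OF x(2)], of x] by simp
qed

lemma DC_trans: "x \<in> DC g \<Longrightarrow> g \<in> DC h \<Longrightarrow> x \<in> DC h"
  unfolding double_coset_eq[of g] by (auto intro: DC_mult)

lemma DC_eq: "x \<in> DC g \<Longrightarrow> DC x = DC g"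
  using DC_sym DC_trans by blast

text \<open>\<open>omega d y\<close> says that \<open>y\<close> is a power of \<open>t\<close>, and \<open>d\<close> whether the power is even. These elements normalise
  the parahoric subgroup and act on its reductive quotient through \<open>twist d\<close>.\<close>

definition omega :: "bool \<Rightarrow> ('f, 'k::finite) bmat \<Rightarrow> bool" where
  "omega d y \<longleftrightarrow> (\<exists>a b. y = W d a b \<and> offset d a b = 0)"

lemma omega_GL: "omega d y \<Longrightarrow> y \<in> GL"
  by (auto simp: omega_def)

lemma omega_conj:
  assumes "omega d y" "g \<in> P"
  shows "y ** g ** matrix_inv y \<in> P"
proof -
  obtain a b where "y = W d a b" "offset d a b = 0"
    using assms(1) by (auto simp: omega_def)
  with PG_zero_conj[OF assms(2), of d a b] show ?thesis
    by simp
qed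

lemma omega_conj_inv: "omega d y \<Longrightarrow> g \<in> P \<Longrightarrow> matrix_inv y ** g ** y \<in> P"
  by (auto simp: omega_def intro: PG_zero_conj_inv)

lemma omega_one: "omega True (mat 1)"
  unfolding omega_def W_one by (intro exI[of _ 0]) (simp add: offset_def)

lemma omega_mult:
  assumes "omega d x" "omega d' y"
  shows "omega (d = d') (x ** y)"
proof -
  obtain a b a' b' where *: "x = W d a b" "offset d a b = 0" "y = W d' a' b'" "offset d' a' b' = 0"
    using assms by (auto simp: omega_def)
  obtain a'' b'' where xy: "x ** y = W (d = d') a'' b''"
    using W_mult_ex[of d a b d' a' b'] * by blast
  then show ?thesis
    using offset_mult[OF xy[unfolded *]] * by (auto simp: omega_def)
qed

lemma omega_inv: "omega d x \<Longrightarrow> omega d (matrix_inv x)"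
  unfolding omega_def by (cases d) (auto simp: W_inv offset_def)

definition twist :: "bool \<Rightarrow> ('q, 'k::finite) levi \<Rightarrow> ('q, 'k) levi" where
  "twist d m = (if d then m else prod.swap m)"

lemma twist_Levi [simp]: "twist d m \<in> Levi \<longleftrightarrow> m \<in> Levi"
  by (cases m) (auto simp: twist_def Levi_def)

lemma twist_twist: "twist d (twist d' m) = twist (d = d') m"
  by (simp add: twist_def)

lemma twist_one [simp]: "twist d (mat 1, mat 1) = (mat 1, mat 1)"
  by (simp add: twist_def)

lemma twist_True [simp]: "twist True m = m"
  by (simp add: twist_def)

lemma omega_reduction: "omega d y \<Longrightarrow> reduction res (y ** g ** matrix_inv y) = twist d (reduction res g)"
  by (auto simp: omega_def reduction_conj twist_def)

lemma reduction_one [simp]: "reduction res (mat 1) = (mat 1, mat 1)"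
  by (simp add: reduction_eq)

section \<open>Coset representatives in the double coset of a simple reflection\<close>

abbreviation "w0 \<equiv> W False 0 0"

lemma inv_w0 [simp]: "matrix_inv w0 = w0" and w0_w0 [simp]: "w0 ** w0 = mat 1" "x ** w0 ** w0 = x"
  by (simp_all add: W_inv W_mult W_one flip: matrix_mul_assoc)
     (simp flip: W_one)

text \<open>As the conjugate of \<open>P\<close> by \<open>w0\<close>, the group \<open>PG 1\<close>
  stabilises the coset of \<open>w0\<close>.\<close>

lemma w0_conj_PG1: "g \<in> PG 1 \<Longrightarrow> w0 ** g ** w0 \<in> P"
  using PG_conj[of g 1 False 0 0] by (simp add: offset_def)

lemma w0_upper: "w0 ** upper_unip B ** w0 = lower_unip B"
  by (simp add: weyl_elt_def)

text \<open>For \<open>y\<close> and \<open>s\<close> of length zero these represent the left cosets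
  of \<open>P\<close> in the double coset of \<open>y ** w0 ** matrix_inv s\<close>, one for each
  matrix \<open>B\<close> over the residue field.\<close>

definition rep :: "('f, 'k::finite) bmat \<Rightarrow> ('f, 'k) bmat \<Rightarrow> 'q^'k^'k \<Rightarrow> ('f, 'k) bmat" where
  "rep y s B = y ** upper_unip (lift B) ** w0 ** matrix_inv s"

text \<open>After splitting off the upper unipotent factor of \<open>p\<close>, both the rest and
  the error made by lifting its reduction lie in \<open>PG 1\<close>, and so pass through
  \<open>w0\<close> into \<open>P\<close>.\<close>

lemma P_w0:
  assumes p: "p \<in> P"
  shows "\<exists>B. \<exists>q\<in>P. p ** w0 = upper_unip (lift B) ** w0 ** q"
proof -
  obtain B0 q0 where q0: "p = upper_unip B0 ** q0" "E 0 B0" "q0 \<in> P" "ur q0 = 0"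
    using PG_zero_factor_upper[OF p] .
  define B where "B = R B0"
  have "R (B0 - lift B) = 0"
    using q0 by (simp add: R_diff B_def)
  then have "E 1 (B0 - lift B)"
    using q0 R_eq_0_iff[of "B0 - lift B"] by (simp add: E_diff)
  then have "upper_unip (B0 - lift B) ** q0 \<in> PG 1"
    using PG_mult[OF upper_unip_PG PG_zero_ur_zero(1)[OF q0(3,4)]] by simp
  then have *: "w0 ** (upper_unip (B0 - lift B) ** q0) ** w0 \<in> P"
    by (rule w0_conj_PG1)
  have "upper_unip B0 = upper_unip (lift B) ** upper_unip (B0 - lift B)"
    by simp
  then have "p ** w0 = upper_unip (lift B) ** w0 ** (w0 ** (upper_unip (B0 - lift B) ** q0) ** w0)"
    unfolding q0(1) by (simp only: matrix_mul_assoc w0_w0)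
  with * show ?thesis
    by blast
qed

lemma rep_GL: "omega dy y \<Longrightarrow> omega ds s \<Longrightarrow> rep y s B \<in> GL"
  by (simp add: rep_def omega_GL)

lemma rep_eq:
  assumes "omega dy y"
  shows "rep y s B = (y ** upper_unip (lift B) ** matrix_inv y) ** (y ** w0 ** matrix_inv s)"
  using omega_GL[OF assms] by (simp add: rep_def matrix_mul_assoc)

lemma inv_rep:
  assumes "omega dy y" "omega ds s"
  shows "matrix_inv (rep y s B) = s ** w0 ** upper_unip (- lift B) ** matrix_inv y"
  using assms by (simp add: rep_def omega_GL inv_mult matrix_mul_assoc)

text \<open>Since \<open>y\<close> and \<open>s\<close> normalise \<open>P\<close>, the
  decomposition of \<open>P w0\<close> carries over.\<close>

lemma rep_cover:
  assumes y: "omega dy y" and s: "omega ds s" and x: "x \<in> DC (y ** w0 ** matrix_inv s)"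
  shows "\<exists>B. x \<in> coset (rep y s B)"
proof -
  have GL: "y \<in> GL" "s \<in> GL"
    using y s omega_GL by auto
  obtain p q where x: "x = p ** (y ** w0 ** matrix_inv s) ** q" "p \<in> P" "q \<in> P"
    using x by (auto simp: double_coset_eq)
  obtain B q' where B: "(matrix_inv y ** p ** y) ** w0 = upper_unip (lift B) ** w0 ** q'" "q' \<in> P"
    using P_w0[OF omega_conj_inv[OF y x(2)]] by blast
  have "x = y ** (matrix_inv y ** p ** y ** w0) ** matrix_inv s ** q"
    using GL by (simp add: x matrix_mul_assoc)
  also have "\<dots> = rep y s B ** ((s ** q' ** matrix_inv s) ** q)"
    using GL by (simp add: B rep_def matrix_mul_assoc)
  finally show ?thesis
    unfolding coset_def using PG_mult[OF omega_conj[OF s B(2)] x(3)] by blast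
qed

text \<open>Two representatives differ, up to conjugation by \<open>s\<close>, by a lower unipotent
  matrix built from the difference of the lifts; membership in \<open>P\<close> puts that difference
  in the maximal ideal.\<close>

lemma rep_inj:
  assumes y: "omega dy y" and s: "omega ds s" and eq: "coset (rep y s B) = coset (rep y s B')"
  shows "B = B'"
proof -
  have GL: "y \<in> GL" "s \<in> GL"
    using y s omega_GL by auto
  have "matrix_inv (rep y s B) ** rep y s B' \<in> P"
    using eq coset_self mem_coset_iff[OF rep_GL[OF y s]] by blast
  moreover have "matrix_inv (rep y s B) ** rep y s B' =
      s ** (w0 ** (upper_unip (- lift B) ** upper_unip (lift B')) ** w0) ** matrix_inv s"
    using GL unfolding inv_rep[OF y s] by (simp add: rep_def matrix_mul_assoc del: block_mult)
  ultimately have "s ** (w0 ** (upper_unip (lift B' - lift B)) ** w0) ** matrix_inv s \<in> P"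
    by simp
  from omega_conj_inv[OF s this] have "lower_unip (lift B' - lift B) \<in> P"
    using GL by (simp add: w0_upper matrix_mul_assoc)
  then have "R (lift B' - lift B) = 0"
    by (intro R_eq_0) (simp add: lower_unip_PG)
  then show ?thesis
    by (simp add: R_diff)
qed

text \<open>By definition \<open>w'_mat \<pi>\<close> is the conjugate of \<open>w_mat\<close> by
  \<open>t_mat \<pi>\<close>, so every simple reflection can be treated as a conjugate of
  \<open>w0\<close> by an element of length zero.\<close>

lemma simple_refl_omega:
  assumes "s \<in> simple_refls \<pi>"
  obtains d y where "omega d y" "s = y ** w0 ** matrix_inv y"
proof -
  have "omega False (W False 0 1)"
    by (force simp: omega_def offset_def)
  moreover have "w_mat = mat 1 ** w0 ** matrix_inv (mat 1)"
    by (simp add: W_simps)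
  moreover have "w'_mat \<pi> = W False 0 1 ** w0 ** matrix_inv (W False 0 1)"
    by (simp add: w'_eq W_mult W_inv)
  ultimately show thesis
    using assms that omega_one unfolding simple_refls_def by blast
qed

section \<open>Finiteness of the set of left cosets in a double coset\<close>

lemma finite_cosets_omega:
  assumes "omega d y"
  shows "finite (coset ` DC y)"
proof -
  have "coset x = coset y" if "x \<in> DC y" for x
  proof -
    obtain p q where x: "x = p ** y ** q" "p \<in> P" "q \<in> P"
      using \<open>x \<in> DC y\<close> by (auto simp: double_coset_eq)
    then have "x = y ** ((matrix_inv y ** p ** y) ** q)"
      using omega_GL[OF assms] by (simp add: matrix_mul_assoc)
    then show ?thesis
      using coset_mult[OF PG_mult[OF omega_conj_inv[OF assms x(2)] x(3)]] by simp
  qed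
  then have "coset ` DC y \<subseteq> {coset y}"
    by blast
  then show ?thesis
    by (rule finite_subset) simp
qed

text \<open>The set \<open>P s \<eta> P\<close> is covered by finitely many translates of
  \<open>P \<eta> P\<close>, one for each coset in \<open>P s P\<close>.\<close>

lemma finite_cosets_mult:
  assumes "s \<in> simple_refls \<pi>" "finite (coset ` DC \<eta>)"
  shows "finite (coset ` DC (s ** \<eta>))"
proof -
  obtain d y where y: "omega d y" "s = y ** w0 ** matrix_inv y"
    using simple_refl_omega[OF assms(1)] .
  have "coset x \<in> (\<Union>B. (\<lambda>C. (**) (rep y y B) ` C) ` (coset ` DC \<eta>))" if "x \<in> DC (s ** \<eta>)" for x
  proof -
    obtain p q where x: "x = p ** (s ** \<eta>) ** q" "p \<in> P" "q \<in> P"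
      using \<open>x \<in> DC (s ** \<eta>)\<close> by (auto simp: double_coset_eq)
    have "p ** s \<in> DC s"
      using DC_mult_left[OF DC_self x(2)] .
    then obtain B p' where B: "p ** s = rep y y B ** p'" "p' \<in> P"
      using rep_cover[OF y(1) y(1), of "p ** s"] y(2) by (auto simp: coset_def)
    then have "x = rep y y B ** (p' ** \<eta> ** q)"
      by (simp add: x matrix_mul_assoc)
    then have "coset x = (**) (rep y y B) ` coset (p' ** \<eta> ** q)"
      by (simp add: coset_translate)
    moreover have "p' ** \<eta> ** q \<in> DC \<eta>"
      using B x by (simp add: DC_I)
    ultimately show ?thesis
      by blast
  qed
  then have "coset ` DC (s ** \<eta>) \<subseteq> (\<Union>B. (\<lambda>C. (**) (rep y y B) ` C) ` (coset ` DC \<eta>))"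
    by blast
  moreover have "finite (\<Union>B. (\<lambda>C. (**) (rep y y B) ` C) ` (coset ` DC \<eta>))"
    using assms(2) by simp
  ultimately show ?thesis
    by (rule finite_subset)
qed

lemma finite_cosets_W: "finite (coset ` DC (W d a b :: ('f, 'k::finite) bmat))"
proof -
  obtain ss :: "('f, 'k) bmat list" and i where ss: "set ss \<subseteq> simple_refls \<pi>"
    "W d a b = foldr (**) ss (mat_powi (t_mat \<pi>) i)"
    using W_word[of d a b] by blast
  have "omega (even i) (mat_powi (t_mat \<pi>) i :: ('f, 'k) bmat)"
    unfolding t_pow omega_def by (force simp: offset_def elim!: evenE oddE)
  with ss(1) have "finite (coset ` DC (foldr (**) ss (mat_powi (t_mat \<pi>) i)))"
    by (induction ss) (simp_all add: finite_cosets_omega finite_cosets_mult)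
  then show ?thesis
    by (simp add: ss)
qed

end

section \<open>Bi-equivariant functions and convolution\<close>

locale hecke_setup = local_field_uniformizer val res \<pi>
  for val :: "'f::field \<Rightarrow> int" and res :: "'f \<Rightarrow> 'q::{field,finite}" and \<pi> :: 'f +
  fixes smul :: "'r::field \<Rightarrow> 'v::ab_group_add \<Rightarrow> 'v"
    and \<sigma> :: "('q, 'k::finite) levi \<Rightarrow> 'v \<Rightarrow> 'v"
  assumes vector_space: "vector_space smul"
    and representation: "representation smul \<sigma>"
begin

sublocale V: vector_space_pair smul smul
  by (intro vector_space_pair.intro vector_space)

abbreviation "lin \<equiv> Vector_Spaces.linear smul smul"

text \<open>The inflation of \<sigma> to the parahoric subgroup.\<close>

abbreviation sred :: "('f, 'k) bmat \<Rightarrow> 'v \<Rightarrow> 'v" where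
  "sred p \<equiv> \<sigma> (reduction res p)"

lemma lin_compose: "lin f \<Longrightarrow> lin g \<Longrightarrow> lin (f \<circ> g)"
  by (rule Vector_Spaces.linear_compose)

lemma lin_sigma: "m \<in> Levi \<Longrightarrow> lin (\<sigma> m)"
  using representation by (auto simp: representation_def)

lemma sigma_one [simp]: "\<sigma> (mat 1, mat 1) = id"
  using representation by (auto simp: representation_def)

lemma sigma_mult: "(a, b) \<in> Levi \<Longrightarrow> (c, d) \<in> Levi \<Longrightarrow> \<sigma> (a ** c, b ** d) = \<sigma> (a, b) \<circ> \<sigma> (c, d)"
  using representation by (fastforce simp: representation_def)

lemma lin_sred: "p \<in> P \<Longrightarrow> lin (sred p)"
  by (simp add: lin_sigma reduction_Levi)

lemma sred_mult: "p \<in> P \<Longrightarrow> q \<in> P \<Longrightarrow> sred (p ** q) = sred p \<circ> sred q"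
  using sigma_mult[of "fst (reduction res p)" "snd (reduction res p)" "fst (reduction res q)" "snd (reduction res q)"]
  by (simp add: reduction_mult reduction_Levi)

lemma sred_inv: "p \<in> P \<Longrightarrow> sred p \<circ> sred (matrix_inv p) = id" "p \<in> P \<Longrightarrow> sred (matrix_inv p) \<circ> sred p = id"
  by (simp_all add: PG_inv PG_GL flip: sred_mult)

lemma sred_inv': "p \<in> P \<Longrightarrow> sred p (sred (matrix_inv p) v) = v" "p \<in> P \<Longrightarrow> sred (matrix_inv p) (sred p v) = v"
  using sred_inv[of p] by (auto simp: fun_eq_iff)

text \<open>Membership in the Hecke algebra apart from finiteness of the support, which is clear for
  functions living on a single double coset.\<close>

definition biequiv :: "(('f, 'k) bmat \<Rightarrow> 'v \<Rightarrow> 'v) \<Rightarrow> bool" where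
  "biequiv \<phi> \<longleftrightarrow> (\<forall>g. g \<notin> GL \<longrightarrow> \<phi> g = (\<lambda>_. 0)) \<and> (\<forall>g\<in>GL. lin (\<phi> g)) \<and>
     (\<forall>g\<in>GL. \<forall>p\<in>P. \<forall>q\<in>P. \<phi> (p ** g ** q) = sred p \<circ> \<phi> g \<circ> sred q)"

lemma hecke_algebra_iff:
  "\<phi> \<in> hecke_algebra smul val res \<sigma> \<longleftrightarrow> biequiv \<phi> \<and> finite {DC g | g. \<phi> g \<noteq> (\<lambda>_. 0)}"
  by (auto simp: hecke_algebra_def biequiv_def parahoric_eq)

lemma biequiv_nonGL: "biequiv \<phi> \<Longrightarrow> g \<notin> GL \<Longrightarrow> \<phi> g = (\<lambda>_. 0)"
  by (simp add: biequiv_def)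

lemma biequiv_lin: "biequiv \<phi> \<Longrightarrow> g \<in> GL \<Longrightarrow> lin (\<phi> g)"
  by (simp add: biequiv_def)

lemma biequiv_zero: "biequiv \<phi> \<Longrightarrow> \<phi> g 0 = 0"
  by (cases "g \<in> GL") (auto simp: biequiv_nonGL dest: biequiv_lin V.linear_0)

lemma biequiv_both: "biequiv \<phi> \<Longrightarrow> g \<in> GL \<Longrightarrow> p \<in> P \<Longrightarrow> q \<in> P \<Longrightarrow> \<phi> (p ** g ** q) = sred p \<circ> \<phi> g \<circ> sred q"
  by (simp add: biequiv_def)

lemma biequiv_left: "biequiv \<phi> \<Longrightarrow> g \<in> GL \<Longrightarrow> p \<in> P \<Longrightarrow> \<phi> (p ** g) = sred p \<circ> \<phi> g"
  using biequiv_both[of \<phi> g p "mat 1"] by (simp add: PG_one)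

lemma biequiv_right: "biequiv \<phi> \<Longrightarrow> g \<in> GL \<Longrightarrow> q \<in> P \<Longrightarrow> \<phi> (g ** q) = \<phi> g \<circ> sred q"
  using biequiv_both[of \<phi> g "mat 1" q] by (simp add: PG_one)

lemma biequiv_support_DC: "biequiv \<phi> \<Longrightarrow> g \<in> GL \<Longrightarrow> x \<in> DC g \<Longrightarrow> \<phi> g = (\<lambda>_. 0) \<Longrightarrow> \<phi> x = (\<lambda>_. 0)"
  unfolding double_coset_eq by (auto simp: biequiv_both fun_eq_iff lin_sred V.linear_0)

text \<open>Bi-equivariance propagates the value at \<eta> over its double coset. This is the tool
  for recognising a convolution as a \<open>hecke_elt\<close>.\<close>

lemma hecke_elt_unique:
  assumes \<phi>: "biequiv \<phi>" and GL: "\<eta> \<in> GL" and supp: "\<And>g. g \<notin> DC \<eta> \<Longrightarrow> \<phi> g = (\<lambda>_. 0)" and val: "\<phi> \<eta> = f"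
  shows "hecke_elt smul val res \<sigma> \<eta> f = \<phi>"
  unfolding hecke_elt_def
proof (rule the_equality)
  have "{DC g | g. \<phi> g \<noteq> (\<lambda>_. 0)} \<subseteq> {DC \<eta>}"
    using supp DC_eq by blast
  then have "finite {DC g | g. \<phi> g \<noteq> (\<lambda>_. 0)}"
    by (rule finite_subset) simp
  then show "\<phi> \<in> hecke_algebra smul val res \<sigma> \<and> (\<forall>g. g \<notin> DC \<eta> \<longrightarrow> \<phi> g = (\<lambda>_. 0)) \<and> \<phi> \<eta> = f"
    using assms by (simp add: hecke_algebra_iff)
next
  fix \<psi>
  assume \<psi>: "\<psi> \<in> hecke_algebra smul val res \<sigma> \<and> (\<forall>g. g \<notin> DC \<eta> \<longrightarrow> \<psi> g = (\<lambda>_. 0)) \<and> \<psi> \<eta> = f"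
  then have b: "biequiv \<psi>"
    by (simp add: hecke_algebra_iff)
  show "\<psi> = \<phi>"
  proof
    fix g
    show "\<psi> g = \<phi> g"
    proof (cases "g \<in> DC \<eta>")
      case True
      then obtain p q where "p \<in> P" "q \<in> P" "g = p ** \<eta> ** q"
        by (auto simp: double_coset_eq)
      then show ?thesis
        using biequiv_both[OF b GL] biequiv_both[OF \<phi> GL] \<psi> val by simp
    next
      case False
      then show ?thesis
        using \<psi> supp by simp
    qed
  qed
qed

text \<open>Treats both coefficient spaces uniformly: \<open>d\<close> selects endomorphisms of
  \<sigma> or homomorphisms from its twist by \<open>w\<close>.\<close>

definition intertwines :: "bool \<Rightarrow> ('v \<Rightarrow> 'v) \<Rightarrow> bool" where
  "intertwines d f \<longleftrightarrow> lin f \<and> (\<forall>m\<in>Levi. f \<circ> \<sigma> (twist d m) = \<sigma> m \<circ> f)"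

lemma coeff_space_W: "f \<in> coeff_space smul \<sigma> (W d a b :: ('f, 'k) bmat) \<longleftrightarrow> intertwines d f"
  by (auto simp: coeff_space_def is_diagonal_W intertwines_def intertwiners_def w_twist_def twist_def)

lemma intertwines_swap: "intertwines d f \<Longrightarrow> m \<in> Levi \<Longrightarrow> f \<circ> \<sigma> m = \<sigma> (twist d m) \<circ> f"
  using twist_twist[of d d m] by (auto simp: intertwines_def dest: bspec[of _ _ "twist d m"])

lemma intertwines_compose:
  assumes "intertwines d f" "intertwines d' g"
  shows "intertwines (d = d') (f \<circ> g)"
  unfolding intertwines_def
proof (intro conjI ballI)
  fix m :: "('q, 'k) levi"
  assume m: "m \<in> Levi"
  have "(f \<circ> g) \<circ> \<sigma> (twist (d = d') m) = f \<circ> (g \<circ> \<sigma> (twist d' (twist d m)))"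
    by (simp add: twist_twist o_assoc eq_commute)
  also have "\<dots> = (f \<circ> \<sigma> (twist d m)) \<circ> g"
    using assms(2) m by (simp add: intertwines_def o_assoc)
  also have "\<dots> = \<sigma> m \<circ> (f \<circ> g)"
    using assms(1) m by (simp add: intertwines_def o_assoc)
  finally show "(f \<circ> g) \<circ> \<sigma> (twist (d = d') m) = \<sigma> m \<circ> (f \<circ> g)" .
qed (use assms in \<open>simp add: intertwines_def lin_compose\<close>)

lemma W_reduction: "reduction res (W d a b ** g ** matrix_inv (W d a b)) = twist d (reduction res g)"
  by (simp add: reduction_conj twist_def)

text \<open>Well-definedness is the issue. Two decompositions of an element of the double coset
  differ by some \<open>x\<close> in \<open>P\<close> whose conjugate by \<eta> is again in
  \<open>P\<close>; the two reductions agree up to \<open>twist d\<close>, and \<open>f\<close>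
  intertwines exactly this.\<close>

lemma hecke_elt_exists:
  assumes f: "intertwines d f"
  obtains \<phi> where "biequiv \<phi>" "\<And>g. g \<notin> DC (W d a b) \<Longrightarrow> \<phi> g = (\<lambda>_. 0)" "\<phi> (W d a b) = f"
proof -
  define \<eta> :: "('f, 'k) bmat" where "\<eta> = W d a b"
  have GL: "\<eta> \<in> GL"
    by (simp add: \<eta>_def)
  have lin: "lin f"
    using f by (simp add: intertwines_def)
  have key: "sred p \<circ> f \<circ> sred q = sred p' \<circ> f \<circ> sred q'"
    if pq: "p \<in> P" "q \<in> P" "p' \<in> P" "q' \<in> P" and eq: "p ** \<eta> ** q = p' ** \<eta> ** q'" for p q p' q'
  proof -
    define x where "x = q ** matrix_inv q'"
    have x: "x \<in> P"
      using pq by (simp add: x_def PG_mult PG_inv)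
    have "p ** \<eta> ** q ** matrix_inv q' = p' ** \<eta>"
      using eq pq by (simp add: PG_GL)
    then have "p ** \<eta> ** x = p' ** \<eta>"
      by (simp add: x_def matrix_mul_assoc)
    then have "matrix_inv p ** (p ** \<eta> ** x) ** matrix_inv \<eta> = matrix_inv p ** (p' ** \<eta>) ** matrix_inv \<eta>"
      by simp
    then have e: "\<eta> ** x ** matrix_inv \<eta> = matrix_inv p ** p'"
      using GL pq by (simp add: matrix_mul_assoc PG_GL)
    then have "twist d (reduction res x) = reduction res (matrix_inv p ** p')"
      using W_reduction[of d a b x] by (simp add: \<eta>_def)
    then have "f \<circ> sred x = sred (matrix_inv p ** p') \<circ> f"
      using intertwines_swap[OF f reduction_Levi[OF x]] by simp
    also have "\<dots> = sred (matrix_inv p) \<circ> sred p' \<circ> f"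
      using pq by (simp add: sred_mult PG_inv)
    finally have "sred p \<circ> (f \<circ> sred x) \<circ> sred q' = sred p \<circ> sred (matrix_inv p) \<circ> sred p' \<circ> f \<circ> sred q'"
      by (simp add: o_assoc)
    moreover have "sred x \<circ> sred q' = sred q"
      using pq x by (simp add: x_def PG_GL flip: sred_mult)
    ultimately show ?thesis
      using pq by (simp add: sred_inv) (simp add: comp_assoc)
  qed
  \<comment> \<open>The value is read off from an arbitrary decomposition; \<open>key\<close> makes
    the description unique.\<close>
  define \<phi> where "\<phi> g = (if g \<in> DC \<eta> then THE F. \<exists>p\<in>P. \<exists>q\<in>P. g = p ** \<eta> ** q \<and> F = sred p \<circ> f \<circ> sred q
                     else (\<lambda>_. 0))" for g
  have \<phi>: "\<phi> (p ** \<eta> ** q) = sred p \<circ> f \<circ> sred q" if "p \<in> P" "q \<in> P" for p q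
  proof -
    have "(THE F. \<exists>p'\<in>P. \<exists>q'\<in>P. p ** \<eta> ** q = p' ** \<eta> ** q' \<and> F = sred p' \<circ> f \<circ> sred q') = sred p \<circ> f \<circ> sred q"
    proof (rule the_equality)
      show "\<exists>p'\<in>P. \<exists>q'\<in>P. p ** \<eta> ** q = p' ** \<eta> ** q' \<and> sred p \<circ> f \<circ> sred q = sred p' \<circ> f \<circ> sred q'"
        using that by blast
      fix F
      assume "\<exists>p'\<in>P. \<exists>q'\<in>P. p ** \<eta> ** q = p' ** \<eta> ** q' \<and> F = sred p' \<circ> f \<circ> sred q'"
      then obtain p' q' where *: "p' \<in> P" "q' \<in> P" "p ** \<eta> ** q = p' ** \<eta> ** q'" "F = sred p' \<circ> f \<circ> sred q'"
        by blast
      show "F = sred p \<circ> f \<circ> sred q"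
        unfolding *(4) by (rule key[OF that *(1-3), symmetric])
    qed
    then show ?thesis
      using that by (simp add: \<phi>_def DC_I)
  qed
  show thesis
  proof (rule that[of \<phi>])
    show "\<And>g. g \<notin> DC (W d a b) \<Longrightarrow> \<phi> g = (\<lambda>_. 0)"
      by (simp add: \<phi>_def \<eta>_def)
    show "\<phi> (W d a b) = f"
      using \<phi>[OF PG_one PG_one] by (simp add: \<eta>_def)
    show "biequiv \<phi>"
      unfolding biequiv_def
    proof (intro conjI allI impI ballI)
      fix g :: "('f, 'k) bmat"
      show "\<phi> g = (\<lambda>_. 0)" if "g \<notin> GL"
        using that DC_GL[OF _ GL] by (auto simp: \<phi>_def)
      show "lin (\<phi> g)"
      proof (cases "g \<in> DC \<eta>")
        case True
        then show ?thesis
          using lin by (auto simp: double_coset_eq \<phi> intro!: lin_compose lin_sred)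
      next
        case False
        then show ?thesis
          by (simp add: \<phi>_def V.module_hom_zero)
      qed
      fix p q :: "('f, 'k) bmat"
      assume pq: "p \<in> P" "q \<in> P"
      show "\<phi> (p ** g ** q) = sred p \<circ> \<phi> g \<circ> sred q"
      proof (cases "g \<in> DC \<eta>")
        case True
        then obtain p' q' where g: "p' \<in> P" "q' \<in> P" "g = p' ** \<eta> ** q'"
          by (auto simp: double_coset_eq)
        have "p ** g ** q = (p ** p') ** \<eta> ** (q' ** q)"
          by (simp add: g matrix_mul_assoc)
        then show ?thesis
          using pq g by (simp add: \<phi> PG_mult sred_mult) (simp add: comp_assoc)
      next
        case False
        have "p ** g ** q \<notin> DC \<eta>"
        proof
          assume "p ** g ** q \<in> DC \<eta>"
          then have "g \<in> DC \<eta>"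
            using DC_trans[OF DC_sym[OF DC_I[OF pq]]] by blast
          with False show False
            by simp
        qed
        then show ?thesis
          using False pq by (simp add: \<phi>_def fun_eq_iff lin_sred V.linear_0)
      qed
    qed
  qed
qed

lemma hecke_elt_W:
  fixes a b :: int
  assumes "intertwines d f"
  defines "\<phi> \<equiv> hecke_elt smul val res \<sigma> (W d a b) f"
  shows "biequiv \<phi>" "\<And>g. g \<notin> DC (W d a b) \<Longrightarrow> \<phi> g = (\<lambda>_. 0)" "\<phi> (W d a b) = f"
proof -
  obtain \<psi> where \<psi>: "biequiv \<psi>" "\<And>g. g \<notin> DC (W d a b) \<Longrightarrow> \<psi> g = (\<lambda>_. 0)" "\<psi> (W d a b) = f"
    using hecke_elt_exists[OF assms(1)] by blast
  have "\<phi> = \<psi>"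
    unfolding \<phi>_def by (rule hecke_elt_unique[OF \<psi>(1) W_GL \<psi>(2,3)])
  with \<psi> show "biequiv \<phi>" "\<And>g. g \<notin> DC (W d a b) \<Longrightarrow> \<phi> g = (\<lambda>_. 0)" "\<phi> (W d a b) = f"
    by simp_all
qed

section \<open>Convolution as a sum over coset representatives\<close>

lemma convolution_term:
  assumes "biequiv \<phi>" "biequiv \<psi>" "h \<in> GL" "p \<in> P"
  shows "\<phi> (h ** p) (\<psi> (matrix_inv (h ** p) ** g) v) = \<phi> h (\<psi> (matrix_inv h ** g) v)"
proof (cases "g \<in> GL")
  case True
  \<comment> \<open>Translating \<open>h\<close> by \<open>p\<close> contributes
    \<open>sred p\<close> from \<phi> and \<open>sred (matrix_inv p)\<close> from \<psi>, and these
    cancel.\<close>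
  have "matrix_inv (h ** p) ** g = matrix_inv p ** (matrix_inv h ** g)"
    using assms by (simp add: inv_mult PG_GL matrix_mul_assoc)
  then show ?thesis
    using assms True by (simp add: biequiv_right biequiv_left PG_inv sred_inv')
next
  case False
  have "matrix_inv (h ** p) ** g \<notin> GL" "matrix_inv h ** g \<notin> GL"
    using assms False by (simp_all add: GL_mult_iff PG_GL)
  then show ?thesis
    using assms by (simp add: biequiv_nonGL biequiv_zero)
qed

text \<open>Terms do not depend on the representative, and cosets outside the support of \<phi> add
  nothing, so any finite irredundant system covering the support may replace the choices in
  \<open>convolution\<close>.\<close>

lemma convolution_sum:
  assumes \<phi>: "biequiv \<phi>" and \<psi>: "biequiv \<psi>" and fin: "finite I" and GL: "\<And>i. i \<in> I \<Longrightarrow> r i \<in> GL"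
    and inj: "inj_on (\<lambda>i. coset (r i)) I" and cover: "\<And>h. \<phi> h \<noteq> (\<lambda>_. 0) \<Longrightarrow> \<exists>i\<in>I. h \<in> coset (r i)"
  shows "convolution val \<phi> \<psi> g v = (\<Sum>i\<in>I. \<phi> (r i) (\<psi> (matrix_inv (r i) ** g) v))"
proof -
  \<comment> \<open>The representatives whose cosets meet the support correspond to the cosets over
    which \<open>convolution\<close> sums.\<close>
  define J where "J = {i \<in> I. \<phi> (r i) \<noteq> (\<lambda>_. 0)}"
  have zero_coset: "\<phi> (r i) = (\<lambda>_. 0) \<Longrightarrow> h \<in> coset (r i) \<Longrightarrow> \<phi> h = (\<lambda>_. 0)" if "i \<in> I" for h i
    using \<phi> GL[OF that] by (auto simp: coset_def biequiv_right fun_eq_iff)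
  have set: "{C \<in> left_cosets val. \<exists>h\<in>C. \<phi> h \<noteq> (\<lambda>_. 0)} = (\<lambda>i. coset (r i)) ` J"
  proof (intro equalityI subsetI)
    fix C
    assume "C \<in> {C \<in> left_cosets val. \<exists>h\<in>C. \<phi> h \<noteq> (\<lambda>_. 0)}"
    then obtain h0 h where h: "C = coset h0" "h \<in> C" "\<phi> h \<noteq> (\<lambda>_. 0)"
      by (auto simp: left_cosets_def coset_def parahoric_eq)
    then obtain i where i: "i \<in> I" "h \<in> coset (r i)"
      using cover by blast
    then have "C = coset (r i)"
      using h coset_eqI by blast
    moreover have "i \<in> J"
      using zero_coset i h by (auto simp: J_def)
    ultimately show "C \<in> (\<lambda>i. coset (r i)) ` J"
      by blast
  next
    fix C
    assume "C \<in> (\<lambda>i. coset (r i)) ` J"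
    then obtain i where "i \<in> J" "C = coset (r i)"
      by blast
    then show "C \<in> {C \<in> left_cosets val. \<exists>h\<in>C. \<phi> h \<noteq> (\<lambda>_. 0)}"
      using coset_self GL by (fastforce simp: J_def left_cosets_def coset_def parahoric_eq)
  qed
  have trm: "(let h = SOME h. h \<in> coset (r i) in \<phi> h (\<psi> (matrix_inv h ** g) v)) =
      \<phi> (r i) (\<psi> (matrix_inv (r i) ** g) v)" if "i \<in> I" for i
  proof -
    have "(SOME h. h \<in> coset (r i)) \<in> coset (r i)"
      using coset_self by (rule someI)
    then obtain p where "p \<in> P" "(SOME h. h \<in> coset (r i)) = r i ** p"
      by (auto simp: coset_def)
    then show ?thesis
      using convolution_term[OF \<phi> \<psi> GL[OF that]] by (simp add: Let_def)
  qed
  have "convolution val \<phi> \<psi> g v = (\<Sum>i\<in>J. let h = SOME h. h \<in> coset (r i) in \<phi> h (\<psi> (matrix_inv h ** g) v))"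
    unfolding convolution_def set
    by (subst sum.reindex) (use inj in \<open>auto simp: J_def inj_on_def\<close>)
  also have "\<dots> = (\<Sum>i\<in>J. \<phi> (r i) (\<psi> (matrix_inv (r i) ** g) v))"
    by (intro sum.cong refl trm) (simp add: J_def)
  also have "\<dots> = (\<Sum>i\<in>I. \<phi> (r i) (\<psi> (matrix_inv (r i) ** g) v))"
    by (intro sum.mono_neutral_left) (use fin in \<open>auto simp: J_def\<close>)
  finally show ?thesis .
qed

lemma coset_system:
  assumes "finite (coset ` DC \<eta>)" "\<eta> \<in> GL"
  obtains I where "finite I" "I \<subseteq> DC \<eta>" "inj_on coset I" "DC \<eta> \<subseteq> (\<Union>i\<in>I. coset i)"
proof -
  obtain I where I: "I \<subseteq> DC \<eta>" "inj_on coset I" "coset ` DC \<eta> = coset ` I"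
    by (metis subset_image_inj order_refl)
  show thesis
  proof (rule that)
    show "finite I"
      using assms I finite_image_iff by metis
    show "DC \<eta> \<subseteq> (\<Union>i\<in>I. coset i)"
      unfolding I(3)[symmetric] using coset_self by blast
  qed (use I in auto)
qed

text \<open>A nonzero sum has a nonzero term, so the support of a product lies in the product of the
  supports.\<close>

lemma convolution_nonzero:
  assumes \<phi>: "biequiv \<phi>" and \<psi>: "biequiv \<psi>" and \<eta>: "\<eta> \<in> GL" "finite (coset ` DC \<eta>)"
    and supp: "\<And>h. h \<notin> DC \<eta> \<Longrightarrow> \<phi> h = (\<lambda>_. 0)" and nz: "convolution val \<phi> \<psi> g \<noteq> (\<lambda>_. 0)"
  obtains h x where "h \<in> DC \<eta>" "\<psi> x \<noteq> (\<lambda>_. 0)" "g = h ** x"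
proof -
  obtain I where I: "finite I" "I \<subseteq> DC \<eta>" "inj_on coset I" "DC \<eta> \<subseteq> (\<Union>i\<in>I. coset i)"
    by (rule coset_system[OF \<eta>(2,1)])
  obtain v where "convolution val \<phi> \<psi> g v \<noteq> 0"
    using nz by (auto simp: fun_eq_iff)
  moreover have "convolution val \<phi> \<psi> g v = (\<Sum>i\<in>I. \<phi> i (\<psi> (matrix_inv i ** g) v))"
    using I \<eta> DC_GL supp by (intro convolution_sum[OF \<phi> \<psi>, of I "\<lambda>i. i"]) blast+
  ultimately obtain i where i: "i \<in> I" "\<phi> i (\<psi> (matrix_inv i ** g) v) \<noteq> 0"
    using sum.not_neutral_contains_not_neutral[of "\<lambda>i. \<phi> i (\<psi> (matrix_inv i ** g) v)" I] by auto
  then have "\<psi> (matrix_inv i ** g) \<noteq> (\<lambda>_. 0)"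
    using biequiv_zero[OF \<phi>] by auto
  moreover have "g = i ** (matrix_inv i ** g)"
    using i I(2) DC_GL[OF _ \<eta>(1)] by (auto intro: sym)
  ultimately show thesis
    using that i I by blast
qed

text \<open>Left equivariance results from evaluating the same convolution with all representatives
  translated by the inverse of \<open>p\<close>; right equivariance is inherited from
  \<psi>.\<close>

lemma biequiv_convolution:
  assumes \<phi>: "biequiv \<phi>" and \<psi>: "biequiv \<psi>" and \<eta>: "\<eta> \<in> GL" "finite (coset ` DC \<eta>)"
    and supp: "\<And>h. h \<notin> DC \<eta> \<Longrightarrow> \<phi> h = (\<lambda>_. 0)"
  shows "biequiv (convolution val \<phi> \<psi>)"
proof -
  obtain I where I: "finite I" "I \<subseteq> DC \<eta>" "inj_on coset I" "DC \<eta> \<subseteq> (\<Union>i\<in>I. coset i)"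
    by (rule coset_system[OF \<eta>(2,1)])
  have GL: "i \<in> GL" if "i \<in> I" for i
    using that I \<eta> DC_GL by blast
  have conv: "convolution val \<phi> \<psi> g v = (\<Sum>i\<in>I. \<phi> i (\<psi> (matrix_inv i ** g) v))" for g v
    using I GL supp by (intro convolution_sum[OF \<phi> \<psi>, of I "\<lambda>i. i"]) blast+
  show ?thesis
    unfolding biequiv_def
  proof (intro conjI allI impI ballI)
    fix g :: "('f, 'k) bmat"
    assume "g \<notin> GL"
    then have "\<psi> (matrix_inv i ** g) = (\<lambda>_. 0)" if "i \<in> I" for i
      using GL[OF that] \<psi> by (intro biequiv_nonGL) (simp_all add: GL_mult_iff)
    then show "convolution val \<phi> \<psi> g = (\<lambda>_. 0)"
      by (simp add: fun_eq_iff conv biequiv_zero[OF \<phi>])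
  next
    fix g :: "('f, 'k) bmat"
    assume g: "g \<in> GL"
    have "lin (\<lambda>v. \<phi> i (\<psi> (matrix_inv i ** g) v))" if "i \<in> I" for i
      using lin_compose[OF biequiv_lin[OF \<phi>] biequiv_lin[OF \<psi>], of i "matrix_inv i ** g"] GL[OF that] g
      by (simp add: o_def)
    then have "lin (\<lambda>v. \<Sum>i\<in>I. \<phi> i (\<psi> (matrix_inv i ** g) v))"
      by (intro V.linear_compose_sum ballI)
    moreover have "convolution val \<phi> \<psi> g = (\<lambda>v. \<Sum>i\<in>I. \<phi> i (\<psi> (matrix_inv i ** g) v))"
      by (simp add: fun_eq_iff conv)
    ultimately show "lin (convolution val \<phi> \<psi> g)"
      by simp
  next
    fix g p q :: "('f, 'k) bmat"
    assume g: "g \<in> GL" and p: "p \<in> P" and q: "q \<in> P"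
    have pinv: "matrix_inv p \<in> P" "p \<in> GL" "q \<in> GL"
      using p q by (simp_all add: PG_inv PG_GL)
    show "convolution val \<phi> \<psi> (p ** g ** q) = sred p \<circ> convolution val \<phi> \<psi> g \<circ> sred q"
    proof
      fix v
      have "convolution val \<phi> \<psi> g (sred q v) =
          (\<Sum>i\<in>I. \<phi> (matrix_inv p ** i) (\<psi> (matrix_inv (matrix_inv p ** i) ** g) (sred q v)))"
      proof (rule convolution_sum[OF \<phi> \<psi> I(1)])
        show "inj_on (\<lambda>i. coset (matrix_inv p ** i)) I"
        proof (rule inj_onI)
          fix i j
          assume ij: "i \<in> I" "j \<in> I" and "coset (matrix_inv p ** i) = coset (matrix_inv p ** j)"
          then have "(**) p ` coset (matrix_inv p ** i) = (**) p ` coset (matrix_inv p ** j)"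
            by simp
          then have "coset i = coset j"
            using pinv by (simp flip: coset_translate)
          then show "i = j"
            using I(3) ij by (auto dest: inj_onD)
        qed
        show "\<exists>i\<in>I. h \<in> coset (matrix_inv p ** i)" if "\<phi> h \<noteq> (\<lambda>_. 0)" for h
        proof -
          have "h \<in> DC \<eta>"
            using that supp by blast
          then obtain i where i: "i \<in> I" "p ** h \<in> coset i"
            using I(4) DC_mult_left p by blast
          then have "matrix_inv p ** (p ** h) \<in> coset (matrix_inv p ** i)"
            unfolding coset_translate by blast
          then show ?thesis
            using i pinv by auto
        qed
      qed (use GL pinv in simp)
      also have "\<dots> = (\<Sum>i\<in>I. sred (matrix_inv p) (\<phi> i (\<psi> (matrix_inv i ** (p ** g ** q)) v)))"
      proof (rule sum.cong[OF refl])
        fix i assume i: "i \<in> I"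
        have "matrix_inv i ** (p ** g ** q) = (matrix_inv i ** p ** g) ** q"
          by (simp add: matrix_mul_assoc)
        then have "\<psi> (matrix_inv i ** (p ** g ** q)) v = \<psi> (matrix_inv i ** p ** g) (sred q v)"
          using GL[OF i] g q pinv \<psi> by (simp add: biequiv_right)
        moreover have "matrix_inv (matrix_inv p ** i) ** g = matrix_inv i ** p ** g"
          using GL[OF i] pinv by (simp add: inv_mult)
        ultimately show "\<phi> (matrix_inv p ** i) (\<psi> (matrix_inv (matrix_inv p ** i) ** g) (sred q v)) =
            sred (matrix_inv p) (\<phi> i (\<psi> (matrix_inv i ** (p ** g ** q)) v))"
          using GL[OF i] pinv \<phi> by (simp add: biequiv_left)
      qed
      also have "\<dots> = sred (matrix_inv p) (convolution val \<phi> \<psi> (p ** g ** q) v)"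
        using lin_sred[OF pinv(1)] by (simp add: conv V.linear_sum)
      finally show "convolution val \<phi> \<psi> (p ** g ** q) v = (sred p \<circ> convolution val \<phi> \<psi> g \<circ> sred q) v"
        using p by (simp add: sred_inv')
    qed
  qed
qed

section \<open>Products with additive lengths\<close>

text \<open>Additivity of lengths gives the indices of
  \<open>\<eta>\<^sup>-\<^sup>1 P \<eta>\<close> and
  \<open>\<delta> P \<delta>\<^sup>-\<^sup>1\<close> weakly opposite signs, as the Iwahori
  factorisation demands.\<close>

lemma additive_factor:
  assumes add: "\<bar>offset d a b + (if d then offset d' a' b' else - offset d' a' b')\<bar> = \<bar>offset d a b\<bar> + \<bar>offset d' a' b'\<bar>"
    and g: "g \<in> P"
  obtains x y where "x \<in> P" "W d a b ** x ** matrix_inv (W d a b) \<in> P"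
    "matrix_inv (W d' a' b') ** y ** W d' a' b' \<in> P" "g = x ** y"
proof -
  \<comment> \<open>This is the index of the conjugate of \<open>P\<close> by the inverse of
    \<open>W d a b\<close>.\<close>
  define m where "m = (if d then - offset d a b else offset d a b)"
  define n where "n = offset d' a' b'"
  have "m \<le> 0 \<and> 0 \<le> n \<or> n \<le> 0 \<and> 0 \<le> m"
    using add by (auto simp: m_def n_def abs_if split: if_splits)
  then obtain x y where xy: "x \<in> P" "x \<in> PG m" "y \<in> PG n" "g = x ** y"
    using PG_zero_factor[OF g] by metis
  have "W d a b ** x ** matrix_inv (W d a b) \<in> P"
    using PG_conj[OF xy(2), of d a b] by (auto simp: m_def split: if_splits)
  moreover have "matrix_inv (W d' a' b') ** y ** W d' a' b' \<in> P"
    using PG_zero_conj_inv xy(3) by (simp add: n_def)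
  ultimately show thesis
    using that xy by blast
qed

lemma convolution_additive:
  fixes a b a' b' :: int
  assumes f: "intertwines d f" and g: "intertwines d' g"
    and add: "\<bar>offset d a b + (if d then offset d' a' b' else - offset d' a' b')\<bar> = \<bar>offset d a b\<bar> + \<bar>offset d' a' b'\<bar>"
  shows "convolution val (hecke_elt smul val res \<sigma> (W d a b) f) (hecke_elt smul val res \<sigma> (W d' a' b') g) =
    hecke_elt smul val res \<sigma> (W d a b ** W d' a' b') (f \<circ> g)"
proof -
  define \<eta> \<delta> :: "('f, 'k) bmat" where "\<eta> = W d a b" and "\<delta> = W d' a' b'"
  define \<phi> \<psi> where "\<phi> = hecke_elt smul val res \<sigma> \<eta> f" and "\<psi> = hecke_elt smul val res \<sigma> \<delta> g"
  have \<phi>: "biequiv \<phi>" "\<And>g. g \<notin> DC \<eta> \<Longrightarrow> \<phi> g = (\<lambda>_. 0)" "\<phi> \<eta> = f"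
    unfolding \<phi>_def \<eta>_def using hecke_elt_W[OF f] by blast+
  have \<psi>: "biequiv \<psi>" "\<And>g. g \<notin> DC \<delta> \<Longrightarrow> \<psi> g = (\<lambda>_. 0)" "\<psi> \<delta> = g"
    unfolding \<psi>_def \<delta>_def using hecke_elt_W[OF g] by blast+
  have GL: "\<eta> \<in> GL" "\<delta> \<in> GL"
    by (simp_all add: \<eta>_def \<delta>_def)
  have fin: "finite (coset ` DC \<eta>)"
    unfolding \<eta>_def by (rule finite_cosets_W)
  \<comment> \<open>One part of \<open>q\<close> moves left through \<eta> and becomes
    \<open>X\<close>, the other moves right through \<delta> and becomes \<open>Y\<close>. That
    \<open>X\<close> also lies in \<open>\<eta> P \<eta>\<^sup>-\<^sup>1\<close> is kept for the
    uniqueness of the contributing coset.\<close>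
  have prod: "\<exists>X\<in>P. \<exists>Y\<in>P. matrix_inv \<eta> ** X ** \<eta> \<in> P \<and> p ** \<eta> ** q ** \<delta> = p ** X ** (\<eta> ** \<delta>) ** Y"
    if "q \<in> P" for p q
  proof -
    obtain x y where xy: "x \<in> P" "\<eta> ** x ** matrix_inv \<eta> \<in> P" "matrix_inv \<delta> ** y ** \<delta> \<in> P" "q = x ** y"
      using additive_factor[OF add \<open>q \<in> P\<close>] unfolding \<eta>_def \<delta>_def .
    have "p ** \<eta> ** q ** \<delta> = p ** (\<eta> ** x ** matrix_inv \<eta>) ** (\<eta> ** \<delta>) ** (matrix_inv \<delta> ** y ** \<delta>)"
      using GL by (simp add: xy matrix_mul_assoc)
    moreover have "matrix_inv \<eta> ** (\<eta> ** x ** matrix_inv \<eta>) ** \<eta> \<in> P"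
      using GL xy by (simp add: matrix_mul_assoc)
    ultimately show ?thesis
      using xy by blast
  qed
  have "hecke_elt smul val res \<sigma> (\<eta> ** \<delta>) (f \<circ> g) = convolution val \<phi> \<psi>"
  proof (rule hecke_elt_unique)
    show "biequiv (convolution val \<phi> \<psi>)"
      by (rule biequiv_convolution[OF \<phi>(1) \<psi>(1) GL(1) fin \<phi>(2)])
    show "\<eta> ** \<delta> \<in> GL"
      using GL by simp
    show "convolution val \<phi> \<psi> x = (\<lambda>_. 0)" if x: "x \<notin> DC (\<eta> ** \<delta>)" for x
    proof (rule ccontr)
      assume "convolution val \<phi> \<psi> x \<noteq> (\<lambda>_. 0)"
      then obtain h z where hz: "h \<in> DC \<eta>" "\<psi> z \<noteq> (\<lambda>_. 0)" "x = h ** z"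
        using convolution_nonzero[OF \<phi>(1) \<psi>(1) GL(1) fin \<phi>(2)] by metis
      then have "z \<in> DC \<delta>"
        using \<psi>(2) by blast
      then obtain p q p' q' where pq: "p \<in> P" "q \<in> P" "h = p ** \<eta> ** q" "p' \<in> P" "q' \<in> P" "z = p' ** \<delta> ** q'"
        using hz(1) by (auto simp: double_coset_eq)
      obtain X Y where XY: "X \<in> P" "Y \<in> P" "p ** \<eta> ** (q ** p') ** \<delta> = p ** X ** (\<eta> ** \<delta>) ** Y"
        using prod[OF PG_mult[OF pq(2,4)]] by blast
      have "x = (p ** \<eta> ** (q ** p') ** \<delta>) ** q'"
        by (simp add: hz pq matrix_mul_assoc)
      also have "\<dots> = (p ** X) ** (\<eta> ** \<delta>) ** (Y ** q')"
        unfolding XY(3) by (simp add: matrix_mul_assoc)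
      finally have "x \<in> DC (\<eta> ** \<delta>)"
        using DC_I[OF PG_mult[OF pq(1) XY(1)] PG_mult[OF XY(2) pq(5)]] by simp
      with x show False
        by simp
    qed
    show "convolution val \<phi> \<psi> (\<eta> ** \<delta>) = f \<circ> g"
    proof
      fix v
      obtain I where I: "finite I" "I \<subseteq> DC \<eta>" "inj_on coset I" "DC \<eta> \<subseteq> (\<Union>i\<in>I. coset i)"
        by (rule coset_system[OF fin GL(1)])
      obtain i0 where i0: "i0 \<in> I" "\<eta> \<in> coset i0"
        using I(4) DC_self by blast
      have "convolution val \<phi> \<psi> (\<eta> ** \<delta>) v = (\<Sum>i\<in>I. \<phi> i (\<psi> (matrix_inv i ** (\<eta> ** \<delta>)) v))"
        using I GL DC_GL \<phi>(2) by (intro convolution_sum[OF \<phi>(1) \<psi>(1), of I "\<lambda>i. i"]) blast+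
      also have "\<dots> = (\<Sum>i\<in>{i0}. \<phi> i (\<psi> (matrix_inv i ** (\<eta> ** \<delta>)) v))"
      proof (intro sum.mono_neutral_right ballI)
        fix i
        assume i: "i \<in> I - {i0}"
        then obtain p q where pq: "p \<in> P" "q \<in> P" "i = p ** \<eta> ** q"
          using I(2) by (auto simp: double_coset_eq)
        have iGL: "i \<in> GL"
          using i I(2) DC_GL GL(1) by blast
        \<comment> \<open>Otherwise \<open>p ** X\<close> lies in \<open>P\<close> and in its
          conjugate by \<open>\<eta> ** \<delta>\<close>, hence in the intermediate conjugate by
          \<eta>; this puts \<open>i\<close> into the coset of \<eta>, which belongs to
          \<open>i0\<close>.\<close>
        have "matrix_inv i ** (\<eta> ** \<delta>) \<notin> DC \<delta>"
        proof
          assume "matrix_inv i ** (\<eta> ** \<delta>) \<in> DC \<delta>"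
          then obtain p' q' where p'q': "p' \<in> P" "q' \<in> P" "matrix_inv i ** (\<eta> ** \<delta>) = p' ** \<delta> ** q'"
            by (auto simp: double_coset_eq)
          obtain X Y where XY: "X \<in> P" "Y \<in> P" "matrix_inv \<eta> ** X ** \<eta> \<in> P"
              "p ** \<eta> ** (q ** p') ** \<delta> = p ** X ** (\<eta> ** \<delta>) ** Y"
            using prod[OF PG_mult[OF pq(2) p'q'(1)]] by blast
          have "\<eta> ** \<delta> = i ** (matrix_inv i ** (\<eta> ** \<delta>))"
            using iGL by simp
          also have "\<dots> = (p ** \<eta> ** (q ** p') ** \<delta>) ** q'"
            unfolding p'q'(3) by (simp add: pq matrix_mul_assoc)
          also have "\<dots> = (p ** X) ** (\<eta> ** \<delta>) ** (Y ** q')"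
            unfolding XY(4) by (simp add: matrix_mul_assoc)
          finally have eq: "\<eta> ** \<delta> = (p ** X) ** (\<eta> ** \<delta>) ** (Y ** q')" .
          have PX: "p ** X \<in> P" "Y ** q' \<in> P"
            using pq XY p'q' by (simp_all add: PG_mult)
          have "matrix_inv (p ** X) = matrix_inv (p ** X) ** (\<eta> ** \<delta>) ** matrix_inv (\<eta> ** \<delta>)"
            using GL by simp
          also have "\<dots> = matrix_inv (p ** X) ** ((p ** X) ** (\<eta> ** \<delta>) ** (Y ** q')) ** matrix_inv (\<eta> ** \<delta>)"
            using eq by simp
          also have "\<dots> = (\<eta> ** \<delta>) ** (Y ** q') ** matrix_inv (\<eta> ** \<delta>)"
            using PG_GL[OF PX(1)] GL_cancel_left[of "p ** X" "(\<eta> ** \<delta>) ** (Y ** q')"] by (simp only: matrix_mul_assoc)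
          finally have inv: "matrix_inv (p ** X) = (\<eta> ** \<delta>) ** (Y ** q') ** matrix_inv (\<eta> ** \<delta>)" .
          obtain a'' b'' where ed: "W d a b ** W d' a' b' = (W (d = d') a'' b'' :: ('f, 'k) bmat)"
            using W_mult_ex by blast
          have off: "offset (d = d') a'' b'' = offset d a b + (if d then offset d' a' b' else - offset d' a' b')"
            using offset_mult[OF ed] .
          have "matrix_inv (p ** X) \<in> PG (offset (d = d') a'' b'')"
            unfolding inv \<eta>_def \<delta>_def ed by (rule PG_zero_conj[OF PX(2)])
          \<comment> \<open>By additivity the two summands of the offset of the product have the
            same sign, so the offset of \<eta> lies between 0 and that of the product.\<close>
          moreover have "min 0 (offset (d = d') a'' b'') \<le> offset d a b" "offset d a b \<le> max 0 (offset (d = d') a'' b'')"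
            using add unfolding off by (auto simp: abs_if split: if_splits)
          ultimately have "matrix_inv (p ** X) \<in> PG (offset d a b)"
            using PG_zero_between[OF PG_inv[OF PX(1)]] by blast
          then have "p ** X \<in> PG (offset d a b)"
            using PG_inv[of "matrix_inv (p ** X)"] PG_GL[OF PX(1)] by simp
          then have *: "matrix_inv \<eta> ** (p ** X) ** \<eta> \<in> P"
            unfolding \<eta>_def by (rule PG_zero_conj_inv)
          have "matrix_inv \<eta> ** (p ** X) ** \<eta> = (matrix_inv \<eta> ** p ** \<eta>) ** (matrix_inv \<eta> ** X ** \<eta>)"
            using GL by (simp add: matrix_mul_assoc)
          with * have "matrix_inv \<eta> ** p ** \<eta> \<in> P"
            using PG_mult_iff'[OF XY(3)] by simp
          moreover have "i = \<eta> ** ((matrix_inv \<eta> ** p ** \<eta>) ** q)"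
            using GL by (simp add: pq matrix_mul_assoc)
          ultimately have "coset i = coset \<eta>"
            using coset_mult[OF PG_mult[OF _ pq(2)]] by metis
          then have "coset i = coset i0"
            using coset_eqI[OF i0(2)] by simp
          then show False
            using i i0(1) I(3) by (auto dest: inj_onD)
        qed
        then show "\<phi> i (\<psi> (matrix_inv i ** (\<eta> ** \<delta>)) v) = 0"
          using \<psi>(2) biequiv_zero[OF \<phi>(1)] by simp
      qed (use I i0 in auto)
      also have "\<dots> = \<phi> \<eta> (\<psi> (matrix_inv \<eta> ** (\<eta> ** \<delta>)) v)"
      proof -
        have "i0 \<in> GL"
          using i0 I(2) DC_GL GL(1) by blast
        moreover obtain p where "p \<in> P" "\<eta> = i0 ** p"
          using i0(2) by (auto simp: coset_def)
        ultimately show ?thesis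
          using convolution_term[OF \<phi>(1) \<psi>(1), of i0 p "\<eta> ** \<delta>" v] by simp
      qed
      finally show "convolution val \<phi> \<psi> (\<eta> ** \<delta>) v = (f \<circ> g) v"
        using GL \<phi> \<psi> by simp
    qed
  qed
  then show ?thesis
    by (simp add: \<phi>_def \<psi>_def \<eta>_def \<delta>_def)
qed

end

section \<open>Unipotent radicals attached to singular matrices\<close>

text \<open>A linear right inverse of \<open>A\<close> on its range, written as a matrix.\<close>

lemma generalized_inverse:
  fixes A :: "'a::field^'n^'m"
  obtains G where "A ** G ** A = A"
proof -
  obtain g where g: "Vector_Spaces.linear (*s) (*s) g" "\<forall>v\<in>range ((*v) A). A *v g v = v"
    using vec.linear_exists_right_inverse_on[OF matrix_vector_mul_linear_gen vec.subspace_UNIV, of A] by blast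
  have "A *v (matrix g *v (A *v x)) = A *v x" for x
    using g by (simp add: matrix_works)
  then have "A ** matrix g ** A = A"
    by (simp add: matrix_eq matrix_vector_mul_assoc matrix_mul_assoc)
  with that show thesis .
qed

text \<open>The columns of \<open>X\<close> are a basis of the kernel of \<open>A\<close> extended
  to the whole space, and \<open>S\<close> marks the columns from the kernel; kernel vectors have no
  coordinates outside \<open>S\<close>.\<close>

lemma adapted_basis:
  fixes A :: "'a::field^'k^'k"
  obtains X S where "X \<in> GL" "\<And>j. j \<in> S \<Longrightarrow> A *v column j X = 0"
    "\<And>x j. A *v x = 0 \<Longrightarrow> j \<notin> S \<Longrightarrow> (matrix_inv X *v x) $ j = 0"
proof -
  obtain Z where Z: "Z \<subseteq> {x. A *v x = 0}" "vec.independent Z" "{x. A *v x = 0} \<subseteq> vec.span Z"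
    by (rule vec.maximal_independent_subset)
  define Y where "Y = vec.extend_basis Z"
  have Y: "Z \<subseteq> Y" "vec.independent Y" "vec.span Y = UNIV"
    using vec.extend_basis_superset[OF Z(2)] vec.independent_extend_basis[OF Z(2)]
      vec.span_extend_basis[OF Z(2)] by (auto simp: Y_def)
  have "card Y = CARD('k)"
    using vec.dim_eq_card[of Y UNIV] Y by (simp add: vec_dim_card del: vec.dim_UNIV)
  moreover have "finite Y"
    using vec.finiteI_independent[OF Y(2)] .
  ultimately obtain e where e: "bij_betw e (UNIV :: 'k set) Y"
    using finite_same_card_bij[of "UNIV :: 'k set" Y] by auto
  define X where "X = (\<chi> i j. e j $ i)"
  have col: "column j X = e j" for j
    by (simp add: X_def column_def vec_eq_iff)
  have "columns X = Y"
    using e by (auto simp: columns_def col bij_betw_def)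
  then have X: "X \<in> GL"
    using Y(3) matrix_right_invertible_span_columns[of X] by (auto simp: GL_iff)
  define S where "S = {j. e j \<in> Z}"
  have ax: "matrix_inv X *v e j = axis j 1" for j
  proof -
    have "e j = X *v axis j 1"
      by (simp add: X_def matrix_vector_mult_def axis_def vec_eq_iff if_distrib[of "\<lambda>x. _ * x"] cong: if_cong)
    then show ?thesis
      using X by (simp add: matrix_vector_mul_assoc)
  qed
  show thesis
  proof (rule that[OF X])
    show "A *v column j X = 0" if "j \<in> S" for j
      using that Z(1) by (auto simp: S_def col)
    fix x j
    assume "A *v x = 0" and j: "j \<notin> S"
    then have "x \<in> vec.span Z"
      using Z(3) by blast
    then show "(matrix_inv X *v x) $ j = 0"
    proof (induction rule: vec.span_induct_alt)
      case base
      then show ?case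
        by simp
    next
      case (step c z y)
      obtain i where i: "z = e i"
        using step(1) Y(1) e by (auto simp: bij_betw_def)
      then have "i \<noteq> j"
        using j step(1) by (auto simp: S_def)
      then show ?case
        using step(2) by (simp add: i ax matrix_vector_right_distrib vec.scale axis_def)
    qed
  qed
qed

text \<open>The relevant parabolic subgroup is the stabiliser of the kernel of \<open>A\<close>. An
  element of its unipotent radical is \<open>mat 1 + N\<close>, where \<open>N\<close> maps into the
  kernel and vanishes on it, so \<open>N\<close> factors through \<open>A\<close>.\<close>

lemma singular_matrix_radical:
  fixes A :: "'a::field^'k^'k"
  assumes A0: "A \<noteq> 0" and sing: "A \<notin> GL"
  obtains c X where "X \<in> GL" "\<not> c constant_on UNIV"
    "\<And>u. u \<in> unipotent_radical c X \<Longrightarrow> \<exists>b. A ** b = 0 \<and> u = mat 1 - b ** A"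
proof -
  obtain X S where X: "X \<in> GL" and S: "\<And>j. j \<in> S \<Longrightarrow> A *v column j X = 0"
    "\<And>x j. A *v x = 0 \<Longrightarrow> j \<notin> S \<Longrightarrow> (matrix_inv X *v x) $ j = 0"
    using adapted_basis[of A] by metis
  obtain G where G: "A ** G ** A = A"
    using generalized_inverse .
  \<comment> \<open>Kernel columns get the smaller label, so the entries left free in the radical
    have their row in \<open>S\<close> and their column outside.\<close>
  define c where "c j = (if j \<in> S then 0 else 1 :: nat)" for j
  have AX: "(A ** X) $ i $ j = 0" if "j \<in> S" for i j
    using arg_cong[OF S(1)[OF that], of "\<lambda>v. v $ i"]
    by (simp add: matrix_vector_mult_def column_def matrix_matrix_mult_def)
  \<comment> \<open>Both labels occur: a singular matrix has a nonzero kernel, and the kernel of a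
    nonzero matrix is not the whole space.\<close>
  have "S \<noteq> {}"
  proof
    assume "S = {}"
    then have "matrix_inv X *v x = 0" if "A *v x = 0" for x
      using S(2)[OF that] by (simp add: vec_eq_iff)
    then have "x = 0" if "A *v x = 0" for x
      using that X by (metis GL_inv_right matrix_vector_mul_assoc matrix_vector_mul_lid matrix_vector_mult_0_right)
    then have "\<exists>B. B ** A = mat 1"
      by (simp add: matrix_left_invertible_ker)
    then show False
      using sing by (simp add: GL_def invertible_left_inverse)
  qed
  moreover have "S \<noteq> UNIV"
  proof
    assume "S = UNIV"
    then have "A ** X = 0"
      using AX by (simp add: vec_eq_iff)
    then have "A ** X ** matrix_inv X = 0"
      by simp
    then show False
      using X A0 by simp
  qed
  ultimately have nc: "\<not> c constant_on UNIV"
    by (auto simp: constant_on_def c_def split: if_splits)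
  have "\<exists>b. A ** b = 0 \<and> u = mat 1 - b ** A" if u: "u \<in> unipotent_radical c X" for u
  proof -
    obtain u0 where u0: "u = X ** u0 ** matrix_inv X" "\<forall>i j. c j \<le> c i \<longrightarrow> u0 $ i $ j = mat 1 $ i $ j"
      using u by (auto simp: unipotent_radical_def)
    define N' where "N' = u0 - mat 1"
    define N where "N = X ** N' ** matrix_inv X"
    have N': "N' $ i $ j = 0" if "i \<notin> S \<or> j \<in> S" for i j
      using u0(2)[rule_format, of j i] that by (auto simp: N'_def c_def split: if_splits)
    have uN: "u = mat 1 + N"
      using X by (simp add: u0 N_def N'_def matrix_ring_simps)
    have "A ** X ** N' = 0"
    proof -
      have "(A ** X) $ i $ l * N' $ l $ j = 0" for i j l
        using AX[of l i] N'[of l j] by (cases "l \<in> S") auto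
      then show ?thesis
        by (auto simp: matrix_matrix_mult_def[of "A ** X"] vec_eq_iff intro!: sum.neutral)
    qed
    then have AN: "A ** N = 0"
      by (simp add: N_def matrix_mul_assoc)
    have NK: "N *v x = 0" if x: "A *v x = 0" for x
    proof -
      have "N' $ i $ j * (matrix_inv X *v x) $ j = 0" for i j
        using N'[of i j] S(2)[OF x, of j] by (cases "j \<in> S") auto
      then have "N' *v (matrix_inv X *v x) = 0"
        by (auto simp: matrix_vector_mult_def[of N'] vec_eq_iff intro!: sum.neutral)
      then have "X *v (N' *v (matrix_inv X *v x)) = 0"
        by simp
      then show ?thesis
        by (simp add: N_def matrix_vector_mul_assoc matrix_mul_assoc)
    qed
    have "N *v x = (N ** G ** A) *v x" for x
    proof -
      \<comment> \<open>The vector \<open>x - G *v (A *v x)\<close> lies in the kernel of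
        \<open>A\<close>, where \<open>N\<close> vanishes, so \<open>N\<close> agrees with
        \<open>N ** G ** A\<close>.\<close>
      have "A *v (x - G *v (A *v x)) = 0"
        using G by (simp add: matrix_vector_mult_diff_distrib matrix_vector_mul_assoc matrix_mul_assoc)
      from NK[OF this] show ?thesis
        by (simp add: matrix_vector_mult_diff_distrib matrix_vector_mul_assoc matrix_mul_assoc)
    qed
    then have NGA: "N ** G ** A = N"
      by (simp add: matrix_eq)
    have "A ** (- (N ** G)) = 0"
      using AN by (simp add: matrix_ring_simps)
    moreover have "u = mat 1 - (- (N ** G)) ** A"
      by (simp add: matrix_mult_minus_left NGA uN)
    ultimately show ?thesis
      by blast
  qed
  with that X nc show thesis
    by blast
qed

text \<open>Provides the trivial radical for the Levi factor in which the parabolic subgroup is not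
  proper.\<close>

lemma unipotent_radical_constant:
  assumes "X \<in> GL" "u \<in> unipotent_radical (\<lambda>_. 0) X"
  shows "u = mat 1"
proof -
  obtain u0 where "u = X ** u0 ** matrix_inv X" "\<And>i j. u0 $ i $ j = mat 1 $ i $ j"
    using assms(2) by (auto simp: unipotent_radical_def)
  moreover from this(2) have "u0 = mat 1"
    by (simp add: vec_eq_iff)
  ultimately show ?thesis
    using assms(1) by simp
qed

section \<open>Products of two elements of length one\<close>

text \<open>Identifies the scalar \<tau> with the number of cosets. In characteristic 0 the
  convention \<open>n mod 0 = n\<close> gives the same result.\<close>

lemma of_nat_mod_CHAR: "(of_nat (n mod CHAR('a)) :: 'a::semiring_1) = of_nat n"
proof -
  have "(of_nat n :: 'a) = of_nat (CHAR('a) * (n div CHAR('a)) + n mod CHAR('a))"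
    by simp
  also have "\<dots> = of_nat (n mod CHAR('a))"
    unfolding of_nat_add of_nat_mult by simp
  finally show ?thesis ..
qed

section \<open>Lower unipotent matrices and the big cell\<close>

context local_field_uniformizer
begin

text \<open>The block version of the rank one identity placing a lower unipotent matrix with
  invertible entry in the big Bruhat cell; its diagonal factor is the source of the shape of
  \<open>T_star\<close>.\<close>

lemma lower_unip_big_cell:
  assumes "C \<in> GL"
  shows "lower_unip C = upper_unip (matrix_inv C) ** block (- matrix_inv C) 0 0 C ** w0 ** upper_unip (matrix_inv C)"
  using assms by (simp add: weyl_elt_def matrix_ring_simps)

lemma R_inv:
  assumes "E 0 C" "R C \<in> GL"
  shows "R (matrix_inv C) = matrix_inv (R C)"
proof -
  have "R C ** R (matrix_inv C) = mat 1"
    using integral_inverse[OF assms] assms R_mult[of C "matrix_inv C"] by simp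
  from matrix_inv_unique[OF this] show ?thesis
    by simp
qed

lemma block_diagonal_PG:
  assumes "E 0 A" "R A \<in> GL" "E 0 D" "R D \<in> GL"
  shows "block A 0 0 D \<in> P"
proof -
  have GL: "A \<in> GL" "D \<in> GL"
    using assms integral_inverse by auto
  have *: "block A 0 0 D ** block (matrix_inv A) 0 0 (matrix_inv D) = mat 1"
    using GL by (simp add: block_one)
  show ?thesis
    using GL_I[OF *] assms integral_inverse(2)[of A] integral_inverse(2)[of D]
    by (simp add: PG_def blocks_ge_def matrix_inv_unique[OF *])
qed

text \<open>The big cell identity is integral when \<open>C\<close> is invertible modulo the maximal
  ideal, and \<open>s\<close> and \<open>z\<close> normalise \<open>P\<close>. The reduction of
  \<open>p\<close> yields the summands of \<open>T_star\<close>.\<close>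

lemma lower_unip_unit:
  assumes C: "E 0 C" "R C \<in> GL" and s: "omega ds s" and z: "omega dz z"
  obtains p q where "p \<in> P" "q \<in> P" "s ** lower_unip C ** z = p ** (s ** w0 ** z) ** q"
    "reduction res p = twist ds (- matrix_inv (R C), R C)" "reduction res q = (mat 1, mat 1)"
proof -
  have GL: "s \<in> GL" "z \<in> GL" "C \<in> GL"
    using s z omega_GL integral_inverse[OF C] by auto
  have i: "E 0 (matrix_inv C)" "R (matrix_inv C) = matrix_inv (R C)"
    using integral_inverse[OF C] R_inv[OF C] by auto
  define u where "u = upper_unip (matrix_inv C)"
  define b where "b = block (- matrix_inv C) 0 0 C"
  have u: "u \<in> P"
    unfolding u_def using i by (intro upper_unip_PG)
  have "b \<in> P"
    unfolding b_def using i C GL_uminus[OF GL_inv[OF C(2)]] by (intro block_diagonal_PG) (auto simp: R_uminus)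
  with u have ub: "u ** b \<in> P"
    by (rule PG_mult)
  have red: "reduction res (u ** b) = (- matrix_inv (R C), R C)"
    unfolding u_def b_def using i by (simp add: reduction_eq R_uminus)
  show thesis
  proof (rule that)
    show "s ** (u ** b) ** matrix_inv s \<in> P"
      by (rule omega_conj[OF s ub])
    show "matrix_inv z ** u ** z \<in> P"
      by (rule omega_conj_inv[OF z u])
    have "s ** lower_unip C ** z = s ** (u ** b ** w0 ** u) ** z"
      unfolding u_def b_def by (subst lower_unip_big_cell[OF GL(3)]) (rule refl)
    also have "\<dots> = s ** (u ** b) ** matrix_inv s ** (s ** w0 ** z) ** (matrix_inv z ** u ** z)"
      using GL by (simp add: matrix_mul_assoc)
    finally show "s ** lower_unip C ** z = s ** (u ** b) ** matrix_inv s ** (s ** w0 ** z) ** (matrix_inv z ** u ** z)" .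
    show "reduction res (s ** (u ** b) ** matrix_inv s) = twist ds (- matrix_inv (R C), R C)"
      by (simp add: omega_reduction[OF s] red)
    have "reduction res u = (mat 1, mat 1)"
      by (simp add: u_def reduction_eq)
    then show "reduction res (matrix_inv z ** u ** z) = (mat 1, mat 1)"
      using omega_reduction[OF omega_inv[OF z], of u] GL by simp
  qed
qed

text \<open>Modulo the maximal ideal the lower left block of an element of \<open>P w0 P\<close> is
  a product of two invertible diagonal blocks.\<close>

lemma lower_unip_DC:
  assumes C: "E 0 C" and s: "omega ds s" and z: "omega dz z"
    and mem: "s ** lower_unip C ** z \<in> DC (s ** w0 ** z)"
  shows "R C \<in> GL"
proof -
  have GL: "s \<in> GL" "z \<in> GL"
    using s z omega_GL by auto
  obtain p q where pq: "p \<in> P" "q \<in> P" "s ** lower_unip C ** z = p ** (s ** w0 ** z) ** q"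
    using mem by (auto simp: double_coset_eq)
  define p' q' where "p' = matrix_inv s ** p ** s" and "q' = z ** q ** matrix_inv z"
  have p'q': "p' \<in> P" "q' \<in> P"
    unfolding p'_def q'_def using omega_conj_inv[OF s pq(1)] omega_conj[OF z pq(2)] by auto
  have "lower_unip C = matrix_inv s ** (s ** lower_unip C ** z) ** matrix_inv z"
    using GL by (simp add: matrix_mul_assoc)
  also have "\<dots> = p' ** w0 ** q'"
    unfolding pq(3) p'_def q'_def by (simp add: matrix_mul_assoc)
  finally have "C = ll (p' ** w0 ** q')"
    by (metis block_proj(3))
  then have C_eq: "C = lr p' ** ul q' + ll p' ** ll q'"
    by (simp add: weyl_elt_def)
  have blocks_ge: "blocks_ge 0 p'" "blocks_ge 0 q'"
    using p'q' PG_blocks_ge by auto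
  have "E 1 (ll p' ** ll q')" "E 0 (lr p' ** ul q')" "E 0 (ll p' ** ll q')"
    using blocks_ge E_mult'[of 1 "ll p'" 1 "ll q'"] E_mult'[of 0 "lr p'" 0 "ul q'"] by (auto simp: blocks_ge_def)
  then have "R C = R (lr p') ** R (ul q')"
    using blocks_ge unfolding C_eq by (simp add: R_add R_mult R_eq_0 blocks_ge_def)
  then show ?thesis
    using PG_zero_blocks_GL[OF p'q'(1)] PG_zero_blocks_GL[OF p'q'(2)] by simp
qed

end

section \<open>Evaluation of a product of two elements of length one\<close>

context hecke_setup
begin

text \<open>Reindexing by inversion and by negation gives the two forms, related by the swap, that
  occur according to the parity of \<open>y\<close>.\<close>

lemma T_star_eq: "T_star \<sigma> v = (\<Sum>B\<in>GL. \<sigma> (matrix_inv B, - B) v)" "T_star \<sigma> v = (\<Sum>B\<in>GL. \<sigma> (- B, matrix_inv B) v)"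
proof -
  show "T_star \<sigma> v = (\<Sum>B\<in>GL. \<sigma> (matrix_inv B, - B) v)"
    unfolding T_star_def by (rule sum.reindex_bij_witness[of _ matrix_inv matrix_inv]) auto
  show "T_star \<sigma> v = (\<Sum>B\<in>GL. \<sigma> (- B, matrix_inv B) v)"
    unfolding T_star_def by (rule sum.reindex_bij_witness[of _ uminus uminus]) (auto simp: GL_uminus inv_uminus)
qed

lemma Levi_T: "g \<in> GL \<Longrightarrow> (g, - matrix_inv g) \<in> Levi"
  by (simp add: Levi_def GL_uminus)

text \<open>Moving \<open>(b, a)\<close> across the sum replaces \<open>g\<close> by
  \<open>matrix_inv a ** g ** b\<close>, a permutation of the group, and turns it into
  \<open>(a, b)\<close>.\<close>

lemma intertwines_T_star: "intertwines False (T_star \<sigma>)"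
  unfolding intertwines_def
proof (intro conjI ballI)
  have "lin (\<lambda>v. \<Sum>g\<in>GL. \<sigma> (g, - matrix_inv g) v)"
    by (intro V.linear_compose_sum ballI lin_sigma Levi_T)
  then show "lin (T_star \<sigma>)"
    by (simp add: T_star_def[abs_def])
next
  fix m :: "('q, 'k) levi"
  assume m: "m \<in> Levi"
  obtain a b where ab: "m = (a, b)" "a \<in> GL" "b \<in> GL"
    using m by (auto simp: Levi_def)
  have "(\<Sum>g\<in>GL. \<sigma> (g, - matrix_inv g) (\<sigma> (b, a) v)) = (\<Sum>g\<in>GL. \<sigma> (a, b) (\<sigma> (g, - matrix_inv g) v))" for v
  proof (rule sum.reindex_bij_witness[of _ "\<lambda>h. a ** h ** matrix_inv b" "\<lambda>g. matrix_inv a ** g ** b"])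
    fix g :: "'q^'k^'k"
    assume g: "g \<in> GL"
    show "a ** (matrix_inv a ** g ** b) ** matrix_inv b = g" "matrix_inv a ** (a ** g ** matrix_inv b) ** b = g"
      using ab by (simp_all add: matrix_mul_assoc)
    show "matrix_inv a ** g ** b \<in> GL" "a ** g ** matrix_inv b \<in> GL"
      using ab g by simp_all
    have "\<sigma> (a, b) (\<sigma> (matrix_inv a ** g ** b, - matrix_inv (matrix_inv a ** g ** b)) v) =
        \<sigma> (a ** (matrix_inv a ** g ** b), b ** - matrix_inv (matrix_inv a ** g ** b)) v"
      using ab g Levi_T[of "matrix_inv a ** g ** b"] m by (subst sigma_mult) simp_all
    also have "a ** (matrix_inv a ** g ** b) = g ** b"
      using ab by (simp add: matrix_mul_assoc)
    also have "b ** - matrix_inv (matrix_inv a ** g ** b) = - matrix_inv g ** a"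
      using ab g by (simp add: inv_mult matrix_ring_simps)
    also have "\<sigma> (g ** b, - matrix_inv g ** a) v = \<sigma> (g, - matrix_inv g) (\<sigma> (b, a) v)"
      using ab Levi_T[OF g] by (subst sigma_mult) (simp_all add: Levi_def)
    finally show "\<sigma> (a, b) (\<sigma> (matrix_inv a ** g ** b, - matrix_inv (matrix_inv a ** g ** b)) v) =
      \<sigma> (g, - matrix_inv g) (\<sigma> (b, a) v)" .
  qed
  then show "T_star \<sigma> \<circ> \<sigma> (twist False m) = \<sigma> m \<circ> T_star \<sigma>"
    using lin_sigma[OF m] by (simp add: fun_eq_iff T_star_def ab twist_def V.linear_sum)
qed

text \<open>For \<open>C\<close> of intermediate rank modulo the maximal ideal, conjugating upper unipotent matrices by
  \<open>lower_unip C\<close> produces the unipotent radical of a proper parabolic subgroup, which fixes the values of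
  the function.\<close>

lemma cuspidal_vanishing:
  assumes cusp: "cuspidal \<sigma>" and \<Theta>: "biequiv \<Theta>" and C: "E 0 C" "R C \<noteq> 0" "R C \<notin> GL"
    and y: "omega dy y" and z: "omega dz z"
  shows "\<Theta> (y ** lower_unip C ** z) = (\<lambda>_. 0)"
proof
  fix v
  have GL: "y \<in> GL" "z \<in> GL"
    using y z omega_GL by auto
  obtain c X where X: "X \<in> GL" "\<not> c constant_on UNIV"
    and rad: "\<And>u. u \<in> unipotent_radical c X \<Longrightarrow> \<exists>b. R C ** b = 0 \<and> u = mat 1 - b ** R C"
    using singular_matrix_radical[OF C(2,3)] by metis
  have fixed: "\<sigma> (twist dy (u, mat 1)) (\<Theta> (y ** lower_unip C ** z) v) = \<Theta> (y ** lower_unip C ** z) v"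
    if u: "u \<in> unipotent_radical c X" for u
  proof -
    obtain b where b: "R C ** b = 0" "u = mat 1 - b ** R C"
      using rad[OF u] by blast
    define B where "B = lift b"
    define m where "m = lower_unip C ** upper_unip B ** lower_unip (- C)"
    have B: "E 0 B" "R B = b"
      by (simp_all add: B_def)
    have E: "E 0 (C ** X)" "E 0 (X ** C)" if "E 0 X" for X
      using that C(1) E_mult[of 0 C 0 X] E_mult[of 0 X 0 C] by auto
    \<comment> \<open>As \<open>R C ** b = 0\<close>, the lower left block reduces to 0 and the
      lower right one to the identity, while the upper left one reduces to \<open>u\<close>.\<close>
    have m_eq: "m = block (mat 1 - B ** C) B (- (C ** B ** C)) (mat 1 + C ** B)"
      by (simp add: m_def matrix_ring_simps)
    have "R (C ** B ** C) = 0"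
      using E B C(1) b by (simp add: R_mult)
    then have E1: "E 1 (C ** B ** C)"
      using E B R_eq_0_iff[of "C ** B ** C"] by simp
    have "matrix_inv m = lower_unip C ** upper_unip (- B) ** lower_unip (- C)"
      by (simp only: m_def inv_mult GL_mult GL_lower_unip GL_upper_unip inv_lower_unip inv_upper_unip
          matrix_mul_assoc minus_minus)
    also have "\<dots> = block (mat 1 + B ** C) (- B) (C ** B ** C) (mat 1 - C ** B)"
      by (simp add: matrix_ring_simps)
    finally have inv_m: "matrix_inv m = block (mat 1 + B ** C) (- B) (C ** B ** C) (mat 1 - C ** B)" .
    have mGL: "m \<in> GL"
      unfolding m_def by (intro GL_mult GL_lower_unip GL_upper_unip)
    have "blocks_ge 0 m" "blocks_ge 0 (matrix_inv m)"
      using E1 E B unfolding inv_m by (simp_all add: m_eq blocks_ge_def E_add E_diff)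
    then have mP: "m \<in> P"
      using mGL by (simp add: PG_def)
    have red: "reduction res m = (u, mat 1)"
      using E B C(1) b unfolding m_eq by (simp add: reduction_eq R_diff R_add R_mult)
    define x where "x = y ** lower_unip C ** z"
    have xGL: "x \<in> GL"
      unfolding x_def using GL by (intro GL_mult GL_lower_unip)
    have UP: "upper_unip B \<in> P"
      using B by (intro upper_unip_PG)
    have "lower_unip (- C) ** lower_unip C = mat 1"
      by (simp add: block_one)
    then have "m ** lower_unip C = lower_unip C ** upper_unip B"
      unfolding m_def by (metis matrix_mul_assoc matrix_mul_rid)
    then have "y ** (m ** lower_unip C) ** z = y ** (lower_unip C ** upper_unip B) ** z"
      by simp
    moreover have "(y ** m ** matrix_inv y) ** x = y ** (m ** lower_unip C) ** z"
      unfolding x_def using GL by (simp add: matrix_mul_assoc del: block_mult)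
    moreover have "x ** (matrix_inv z ** upper_unip B ** z) = y ** (lower_unip C ** upper_unip B) ** z"
      unfolding x_def using GL by (simp add: matrix_mul_assoc del: block_mult)
    ultimately have "(y ** m ** matrix_inv y) ** x = x ** (matrix_inv z ** upper_unip B ** z)"
      by simp
    then have "sred (y ** m ** matrix_inv y) \<circ> \<Theta> x = \<Theta> x \<circ> sred (matrix_inv z ** upper_unip B ** z)"
      using biequiv_left[OF \<Theta> xGL omega_conj[OF y mP]] biequiv_right[OF \<Theta> xGL omega_conj_inv[OF z UP]]
      by simp
    moreover have "reduction res (matrix_inv z ** upper_unip B ** z) = (mat 1, mat 1)"
      using omega_reduction[OF omega_inv[OF z], of "upper_unip B"] GL by (simp add: reduction_eq)
    ultimately show ?thesis
      using omega_reduction[OF y, of m] red by (simp add: x_def fun_eq_iff)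
  qed
  \<comment> \<open>The parity of \<open>y\<close> decides which Levi factor carries the radical;
    the other gets the constant labelling.\<close>
  define c1 d1 where "c1 = (if dy then c else (\<lambda>_. 0))" and "d1 = (if dy then (\<lambda>_. 0) else c)"
  have "\<not> (c1 constant_on UNIV \<and> d1 constant_on UNIV)"
    using X(2) by (auto simp: c1_def d1_def)
  then have "{v. \<forall>m \<in> unipotent_radical c1 X \<times> unipotent_radical d1 X. \<sigma> m v = v} = {0}"
    using cusp X(1) unfolding cuspidal_def by blast
  moreover have "\<forall>m \<in> unipotent_radical c1 X \<times> unipotent_radical d1 X.
      \<sigma> m (\<Theta> (y ** lower_unip C ** z) v) = \<Theta> (y ** lower_unip C ** z) v"
    using fixed unipotent_radical_constant[OF X(1)] by (auto simp: c1_def d1_def twist_def split: if_splits)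
  ultimately show "\<Theta> (y ** lower_unip C ** z) v = 0"
    by blast
qed

text \<open>Writing the factors with \<open>y\<close>, \<open>s\<close>, \<open>z\<close> of length
  zero reduces all combinations of simple reflections to \<open>w0\<close> against
  \<open>w0\<close>.\<close>

lemma convolution_length_one:
  assumes cusp: "cuspidal \<sigma>"
    and y: "omega dy y" and s: "omega ds s" and z: "omega dz z"
    and \<eta>: "y ** w0 ** matrix_inv s = W d\<eta> a b" and \<delta>: "s ** w0 ** z = W d\<delta> a' b'"
    and f: "intertwines d\<eta> f" and g: "intertwines d\<delta> g"
  shows "convolution val (hecke_elt smul val res \<sigma> (y ** w0 ** matrix_inv s) f) (hecke_elt smul val res \<sigma> (s ** w0 ** z) g)
    = (\<lambda>x u. smul (of_nat (CARD('q) ^ (CARD('k)\<^sup>2))) (hecke_elt smul val res \<sigma> (y ** z) (f \<circ> g) x u)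
         + hecke_elt smul val res \<sigma> (y ** w0 ** z) (T_star \<sigma> \<circ> (f \<circ> g)) x u)"
proof -
  have GL: "y \<in> GL" "s \<in> GL" "z \<in> GL"
    using y s z omega_GL by auto
  define \<phi> where "\<phi> = hecke_elt smul val res \<sigma> (y ** w0 ** matrix_inv s) f"
  define \<psi> where "\<psi> = hecke_elt smul val res \<sigma> (s ** w0 ** z) g"
  have \<phi>: "biequiv \<phi>" "\<And>g. g \<notin> DC (y ** w0 ** matrix_inv s) \<Longrightarrow> \<phi> g = (\<lambda>_. 0)" "\<phi> (y ** w0 ** matrix_inv s) = f"
    unfolding \<phi>_def \<eta> using hecke_elt_W[OF f] by blast+
  have \<psi>: "biequiv \<psi>" "\<And>g. g \<notin> DC (s ** w0 ** z) \<Longrightarrow> \<psi> g = (\<lambda>_. 0)" "\<psi> (s ** w0 ** z) = g"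
    unfolding \<psi>_def \<delta> using hecke_elt_W[OF g] by blast+
  have \<eta>GL: "y ** w0 ** matrix_inv s \<in> GL" and \<delta>GL: "s ** w0 ** z \<in> GL"
    using GL by simp_all
  have fin: "finite (coset ` DC (y ** w0 ** matrix_inv s))"
    unfolding \<eta> by (rule finite_cosets_W)
  define \<Theta> where "\<Theta> = convolution val \<phi> \<psi>"
  have \<Theta>: "biequiv \<Theta>"
    unfolding \<Theta>_def by (rule biequiv_convolution[OF \<phi>(1) \<psi>(1) \<eta>GL fin \<phi>(2)])
  obtain ay bY where yW: "y = W dy ay bY"
    using y by (auto simp: omega_def)
  obtain as' bs where sW: "s = W ds as' bs"
    using s by (auto simp: omega_def)
  obtain az bz where zW: "z = W dz az bz"
    using z by (auto simp: omega_def)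
  have flag\<eta>: "d\<eta> = (ds = (\<not> dy))"
    using \<eta> unfolding yW sW by (cases dy; cases ds) (auto simp: W_inv W_mult)
  have flag\<delta>: "d\<delta> = (dz = (\<not> ds))"
    using \<delta> unfolding zW sW by (cases dz; cases ds) (auto simp: W_mult)
  obtain a1 b1 where yz: "y ** z = W (d\<eta> = d\<delta>) a1 b1"
    unfolding yW zW flag\<eta> flag\<delta> by (cases dy; cases ds; cases dz) (auto simp: W_mult)
  obtain a2 b2 where ywz: "y ** w0 ** z = W (False = (d\<eta> = d\<delta>)) a2 b2"
    unfolding yW zW flag\<eta> flag\<delta> by (cases dy; cases ds; cases dz) (auto simp: W_mult)
  define \<phi>1 where "\<phi>1 = hecke_elt smul val res \<sigma> (y ** z) (f \<circ> g)"
  define \<phi>2 where "\<phi>2 = hecke_elt smul val res \<sigma> (y ** w0 ** z) (T_star \<sigma> \<circ> (f \<circ> g))"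
  \<comment> \<open>The composite \<open>f \<circ> g\<close> has the parity of
    \<open>y ** z\<close>; \<open>T_star\<close> reverses it, matching the extra \<open>w0\<close>
    in \<open>y ** w0 ** z\<close>.\<close>
  have fg: "intertwines (d\<eta> = d\<delta>) (f \<circ> g)"
    by (rule intertwines_compose[OF f g])
  have Tfg: "intertwines (False = (d\<eta> = d\<delta>)) (T_star \<sigma> \<circ> (f \<circ> g))"
    by (rule intertwines_compose[OF intertwines_T_star fg])
  have \<phi>1: "biequiv \<phi>1" "\<And>g. g \<notin> DC (y ** z) \<Longrightarrow> \<phi>1 g = (\<lambda>_. 0)" "\<phi>1 (y ** z) = f \<circ> g"
    unfolding \<phi>1_def yz using hecke_elt_W[OF fg] by blast+
  have \<phi>2: "biequiv \<phi>2" "\<And>g. g \<notin> DC (y ** w0 ** z) \<Longrightarrow> \<phi>2 g = (\<lambda>_. 0)"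
      "\<phi>2 (y ** w0 ** z) = T_star \<sigma> \<circ> (f \<circ> g)"
    unfolding \<phi>2_def ywz using hecke_elt_W[OF Tfg] by blast+
  have sum: "\<Theta> x v = (\<Sum>B\<in>UNIV. f (\<psi> (s ** w0 ** upper_unip (- lift B) ** matrix_inv y ** x) v))" for x v
  proof -
    have "\<Theta> x v = (\<Sum>B\<in>UNIV. \<phi> (rep y s B) (\<psi> (matrix_inv (rep y s B) ** x) v))"
      unfolding \<Theta>_def
    proof (rule convolution_sum[OF \<phi>(1) \<psi>(1)])
      show "inj_on (\<lambda>i. coset (rep y s i)) UNIV"
        using rep_inj[OF y s] by (auto intro: injI)
      show "\<exists>i\<in>UNIV. h \<in> coset (rep y s i)" if "\<phi> h \<noteq> (\<lambda>_. 0)" for h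
        using that \<phi>(2) rep_cover[OF y s] by blast
    qed (use rep_GL[OF y s] in auto)
    \<comment> \<open>A representative is the base point multiplied from the left by a conjugate of
      a unipotent matrix with trivial reduction.\<close>
    moreover have "\<phi> (rep y s B) = f" for B
    proof -
      have u: "upper_unip (lift B) \<in> P"
        by (intro upper_unip_PG E_lift)
      have "\<phi> (rep y s B) = sred (y ** upper_unip (lift B) ** matrix_inv y) \<circ> f"
        unfolding rep_eq[OF y] using biequiv_left[OF \<phi>(1) \<eta>GL omega_conj[OF y u]] \<phi>(3) by simp
      also have "sred (y ** upper_unip (lift B) ** matrix_inv y) = id"
        unfolding omega_reduction[OF y] by (simp add: reduction_eq)
      finally show ?thesis
        by simp
    qed
    ultimately show ?thesis
      by (simp add: inv_rep[OF y s])
  qed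
  have val1: "\<Theta> (y ** z) v = smul (of_nat (CARD('q) ^ (CARD('k)\<^sup>2))) (f (g v))" for v
  proof -
    \<comment> \<open>The unipotent factor passes through \<open>z\<close> and acts trivially, so
      every coset contributes equally.\<close>
    have "\<psi> (s ** w0 ** upper_unip (- lift B) ** matrix_inv y ** (y ** z)) = g" for B
    proof -
      have u: "upper_unip (- lift B) \<in> P"
        by (intro upper_unip_PG) simp
      have "s ** w0 ** upper_unip (- lift B) ** matrix_inv y ** (y ** z) =
          (s ** w0 ** z) ** (matrix_inv z ** upper_unip (- lift B) ** z)"
        using GL by (simp add: matrix_mul_assoc del: block_mult)
      moreover have "reduction res (matrix_inv z ** upper_unip (- lift B) ** z) = (mat 1, mat 1)"
        using omega_reduction[OF omega_inv[OF z], of "upper_unip (- lift B)"] GL by (simp add: reduction_eq)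
      ultimately show ?thesis
        using biequiv_right[OF \<psi>(1) \<delta>GL omega_conj_inv[OF z u]] \<psi>(3) by simp
    qed
    then have "\<Theta> (y ** z) v = (\<Sum>B\<in>(UNIV :: ('q^'k^'k) set). f (g v))"
      by (simp only: sum)
    also have "\<dots> = smul (of_nat (CARD('q^'k^'k))) (f (g v))"
      by (rule V.vs1.sum_constant_scale)
    also have "CARD('q^'k^'k) = CARD('q) ^ (CARD('k)\<^sup>2)"
      by (simp add: power2_eq_square flip: power_mult)
    finally show ?thesis .
  qed
  have val2: "\<Theta> (y ** w0 ** z) v = T_star \<sigma> (f (g v))" for v
  proof -
    define F where "F B = f (\<psi> (s ** lower_unip (- lift B) ** z) v)" for B :: "'q^'k^'k"
    have "s ** w0 ** upper_unip (- lift B) ** matrix_inv y ** (y ** w0 ** z) = s ** lower_unip (- lift B) ** z" for B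
    proof -
      have "s ** w0 ** upper_unip (- lift B) ** matrix_inv y ** (y ** w0 ** z) =
          s ** (w0 ** upper_unip (- lift B) ** w0) ** z"
        using GL by (simp add: matrix_mul_assoc del: block_mult)
      then show ?thesis
        by (simp only: w0_upper)
    qed
    then have "\<Theta> (y ** w0 ** z) v = (\<Sum>B\<in>UNIV. F B)"
      by (simp only: sum F_def)
    \<comment> \<open>For singular \<open>B\<close> the argument of \<psi> leaves the double coset
      of \<delta>.\<close>
    also have "\<dots> = (\<Sum>B\<in>GL. F B)"
    proof (intro sum.mono_neutral_right ballI)
      fix B :: "'q^'k^'k"
      assume "B \<in> UNIV - GL"
      then have "R (- lift B) \<notin> GL"
        using GL_uminus[of "- B"] by (auto simp: R_uminus)
      then have "s ** lower_unip (- lift B) ** z \<notin> DC (s ** w0 ** z)"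
        using lower_unip_DC[OF _ s z, of "- lift B"] by auto
      then show "F B = 0"
        using \<psi>(2) f by (simp add: F_def intertwines_def V.linear_0)
    qed auto
    also have "\<dots> = (\<Sum>B\<in>GL. \<sigma> (twist (\<not> dy) (matrix_inv B, - B)) (f (g v)))"
    proof (rule sum.cong[OF refl])
      fix B :: "'q^'k^'k"
      assume B: "B \<in> GL"
      have RB: "R (- lift B) = - B"
        by (simp add: R_uminus)
      have C: "E 0 (- lift B)" "R (- lift B) \<in> GL"
        using B by (simp_all add: RB GL_uminus)
      obtain p q where pq: "p \<in> P" "q \<in> P" "s ** lower_unip (- lift B) ** z = p ** (s ** w0 ** z) ** q"
          "reduction res p = twist ds (- matrix_inv (R (- lift B)), R (- lift B))" "reduction res q = (mat 1, mat 1)"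
        using lower_unip_unit[OF C s z] by metis
      have rp: "reduction res p = twist ds (matrix_inv B, - B)"
        using pq(4) B by (simp add: RB inv_uminus)
      have L: "(matrix_inv B, - B) \<in> Levi"
        using B by (simp add: Levi_def GL_uminus)
      have "\<psi> (s ** lower_unip (- lift B) ** z) = \<sigma> (twist ds (matrix_inv B, - B)) \<circ> g"
        unfolding pq(3) using biequiv_both[OF \<psi>(1) \<delta>GL pq(1,2)] \<psi>(3) by (simp add: rp pq(5))
      then have "F B = (f \<circ> \<sigma> (twist ds (matrix_inv B, - B))) (g v)"
        by (simp add: F_def)
      also have "\<dots> = \<sigma> (twist d\<eta> (twist ds (matrix_inv B, - B))) (f (g v))"
        using intertwines_swap[OF f, of "twist ds (matrix_inv B, - B)"] L by simp
      also have "(d\<eta> = ds) = (\<not> dy)"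
        using flag\<eta> by auto
      then have "twist d\<eta> (twist ds (matrix_inv B, - B)) = twist (\<not> dy) (matrix_inv B, - B)"
        by (simp only: twist_twist)
      finally show "F B = \<sigma> (twist (\<not> dy) (matrix_inv B, - B)) (f (g v))" .
    qed
    also have "\<dots> = T_star \<sigma> (f (g v))"
      by (cases dy) (simp_all add: twist_def T_star_eq(1)[of "f (g v)"] flip: T_star_eq(2))
    finally show ?thesis .
  qed
  have supp: "x \<in> DC (y ** z) \<or> x \<in> DC (y ** w0 ** z)" if nz: "\<Theta> x \<noteq> (\<lambda>_. 0)" for x
  proof -
    obtain h h' where hh: "h \<in> DC (y ** w0 ** matrix_inv s)" "\<psi> h' \<noteq> (\<lambda>_. 0)" "x = h ** h'"
      using convolution_nonzero[OF \<phi>(1) \<psi>(1) \<eta>GL fin \<phi>(2)] nz unfolding \<Theta>_def by metis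
    then have "h' \<in> DC (s ** w0 ** z)"
      using \<psi>(2) by blast
    then obtain p' q' where h': "p' \<in> P" "q' \<in> P" "h' = p' ** (s ** w0 ** z) ** q'"
      by (auto simp: double_coset_eq)
    obtain p q where h: "p \<in> P" "q \<in> P" "h = p ** (y ** w0 ** matrix_inv s) ** q"
      using hh(1) by (auto simp: double_coset_eq)
    have "matrix_inv s ** (q ** p') ** s \<in> P"
      using omega_conj_inv[OF s PG_mult[OF h(2) h'(1)]] .
    then obtain B r where r: "matrix_inv s ** (q ** p') ** s ** w0 = upper_unip (lift B) ** w0 ** r" "r \<in> P"
      using P_w0 by blast
    define C where "C = lift B"
    have C: "E 0 C"
      by (simp add: C_def)
    have "x = p ** y ** w0 ** (matrix_inv s ** (q ** p') ** s ** w0) ** z ** q'"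
      unfolding hh(3) h h' by (simp only: matrix_mul_assoc)
    also have "\<dots> = p ** y ** (w0 ** upper_unip C ** w0) ** r ** z ** q'"
      unfolding r C_def by (simp only: matrix_mul_assoc)
    also have "\<dots> = p ** (y ** lower_unip C ** z) ** (matrix_inv z ** r ** z ** q')"
      unfolding w0_upper using GL by (simp add: matrix_mul_assoc del: block_mult)
    finally have x: "x \<in> DC (y ** lower_unip C ** z)"
      using DC_I[OF h(1) PG_mult[OF omega_conj_inv[OF z r(2)] h'(2)]] by metis
    have lGL: "y ** lower_unip C ** z \<in> GL"
      using GL by (intro GL_mult GL_lower_unip)
    have nz': "\<Theta> (y ** lower_unip C ** z) \<noteq> (\<lambda>_. 0)"
      using biequiv_support_DC[OF \<Theta> lGL x] nz by blast
    \<comment> \<open>The rank of \<open>C\<close> over the residue field decides: rank 0 and full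
      rank give the two double cosets, intermediate rank is excluded by cuspidality.\<close>
    consider "R C = 0" | "R C \<in> GL" | "R C \<noteq> 0" "R C \<notin> GL"
      by blast
    then show ?thesis
    proof cases
      case 1
      then have "lower_unip C \<in> P"
        using C R_eq_0_iff[of C] by (simp add: lower_unip_PG)
      from DC_I[OF omega_conj[OF y this] PG_one, of "y ** z"]
      have "y ** lower_unip C ** z \<in> DC (y ** z)"
        using GL by (simp add: matrix_mul_assoc)
      with x show ?thesis
        using DC_trans by blast
    next
      case 2
      then have "y ** lower_unip C ** z \<in> DC (y ** w0 ** z)"
        using lower_unip_unit[OF C 2 y z] DC_I by metis
      with x show ?thesis
        using DC_trans by blast
    next
      case 3
      then show ?thesis
        using cuspidal_vanishing[OF cusp \<Theta> C 3 y z] nz' by blast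
    qed
  qed
  have disj: "y ** z \<notin> DC (y ** w0 ** z)"
  proof
    assume "y ** z \<in> DC (y ** w0 ** z)"
    then have "y ** lower_unip 0 ** z \<in> DC (y ** w0 ** z)"
      by (simp flip: block_one)
    then have "R (0 :: 'f^'k^'k) \<in> GL"
      by (intro lower_unip_DC[OF _ y z]) simp
    then show False
      by (auto simp: GL_iff)
  qed
  then have disj': "y ** w0 ** z \<notin> DC (y ** z)"
    using DC_sym by blast
  have yzGL: "y ** z \<in> GL" and ywzGL: "y ** w0 ** z \<in> GL"
    using GL by simp_all
  \<comment> \<open>All three functions are bi-equivariant, so the identity spreads from the two
    base points over their disjoint double cosets.\<close>
  have "\<Theta> x v = smul (of_nat (CARD('q) ^ (CARD('k)\<^sup>2))) (\<phi>1 x v) + \<phi>2 x v" for x v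
  proof -
    consider "x \<in> DC (y ** z)" | "x \<in> DC (y ** w0 ** z)" | "x \<notin> DC (y ** z)" "x \<notin> DC (y ** w0 ** z)"
      by blast
    then show ?thesis
    proof cases
      case 1
      then obtain p q where pq: "p \<in> P" "q \<in> P" "x = p ** (y ** z) ** q"
        by (auto simp: double_coset_eq)
      have "x \<notin> DC (y ** w0 ** z)"
        using 1 disj DC_sym DC_trans by blast
      moreover have "\<Theta> x v = sred p (smul (of_nat (CARD('q) ^ (CARD('k)\<^sup>2))) (f (g (sred q v))))"
        unfolding pq(3) using biequiv_both[OF \<Theta> yzGL pq(1,2)] val1 by simp
      moreover have "\<phi>1 x v = sred p (f (g (sred q v)))"
        unfolding pq(3) using biequiv_both[OF \<phi>1(1) yzGL pq(1,2)] \<phi>1(3) by simp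
      ultimately show ?thesis
        using \<phi>2(2) V.linear_scale[OF lin_sred[OF pq(1)]] by simp
    next
      case 2
      then obtain p q where pq: "p \<in> P" "q \<in> P" "x = p ** (y ** w0 ** z) ** q"
        by (auto simp: double_coset_eq)
      have "x \<notin> DC (y ** z)"
        using 2 disj' DC_sym DC_trans by blast
      moreover have "\<Theta> x v = sred p (T_star \<sigma> (f (g (sred q v))))"
        unfolding pq(3) using biequiv_both[OF \<Theta> ywzGL pq(1,2)] val2 by simp
      moreover have "\<phi>2 x v = sred p (T_star \<sigma> (f (g (sred q v))))"
        unfolding pq(3) using biequiv_both[OF \<phi>2(1) ywzGL pq(1,2)] \<phi>2(3) by simp
      ultimately show ?thesis
        using \<phi>1(2) by simp
    next
      case 3
      then have "\<Theta> x = (\<lambda>_. 0)"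
        using supp by blast
      then show ?thesis
        using 3 \<phi>1(2) \<phi>2(2) by simp
    qed
  qed
  then show ?thesis
    unfolding \<Theta>_def \<phi>_def \<psi>_def \<phi>1_def \<phi>2_def by (intro ext) simp
qed

end

section \<open>The product formula for arbitrary Weyl elements, from lengths to offsets\<close>

theorem theorem3p6:
  fixes val :: "'f::field \<Rightarrow> int"
    and res :: "'f \<Rightarrow> 'q::{field,finite}"
    and \<pi> :: 'f
    and smul :: "'r::alg_closed_field \<Rightarrow> 'v::ab_group_add \<Rightarrow> 'v"
    and \<sigma> :: "('q, 'k::finite) levi \<Rightarrow> 'v \<Rightarrow> 'v"
    and \<eta> \<delta> :: "('f, 'k) bmat"
    and f g :: "'v \<Rightarrow> 'v"
  assumes "nonarch_local_field val res"
    and "uniformizer val \<pi>"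
    and "CHAR('r) \<noteq> CHAR('q)"
    and "\<exists>Basis. finite_dimensional_vector_space smul Basis"
    and "representation smul \<sigma>"
    and "cuspidal \<sigma>"
    and "\<eta> \<in> Weyl \<pi>" and "\<delta> \<in> Weyl \<pi>"
    and "f \<in> coeff_space smul \<sigma> \<eta>" and "g \<in> coeff_space smul \<sigma> \<delta>"
  shows
    "(len \<pi> (\<eta> ** \<delta>) = len \<pi> \<eta> + len \<pi> \<delta> \<longrightarrow>
        convolution val (hecke_elt smul val res \<sigma> \<eta> f) (hecke_elt smul val res \<sigma> \<delta> g)
          = hecke_elt smul val res \<sigma> (\<eta> ** \<delta>) (f \<circ> g))
     \<and>
     (\<forall>\<eta>' v. \<eta>' \<in> Weyl \<pi> \<and> v \<in> simple_refls \<pi> \<and> \<eta> = \<eta>' ** v \<and> len \<pi> \<eta> = len \<pi> \<eta>' + 1 \<longrightarrow>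
        len \<pi> \<eta> = 1 \<and> len \<pi> \<delta> = 1 \<and> len \<pi> (\<eta> ** \<delta>) = 0 \<longrightarrow>
        convolution val (hecke_elt smul val res \<sigma> \<eta> f) (hecke_elt smul val res \<sigma> \<delta> g)
          = (\<lambda>x u. smul (of_nat (CARD('q) ^ (CARD('k)\<^sup>2) mod CHAR('r)))
                         (hecke_elt smul val res \<sigma> (\<eta> ** \<delta>) (f \<circ> g) x u)
                   + hecke_elt_T smul val res \<sigma> 1 (\<eta>' ** \<delta>) (f \<circ> g) x u))"
proof -
  obtain Basis where "finite_dimensional_vector_space smul Basis"
    using assms(4) by blast
  then have "vector_space smul"
    by (rule finite_dimensional_vector_space.axioms)
  with assms(1,2,5) interpret hecke_setup val res \<pi> smul \<sigma>
    by (intro hecke_setup.intro hecke_setup_axioms.intro local_field_uniformizer.intro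
        local_field_uniformizer_axioms.intro)
  obtain d a b where \<eta>: "\<eta> = W d a b"
    using Weyl_cases[OF assms(7)] .
  obtain d' a' b' where \<delta>: "\<delta> = W d' a' b'"
    using Weyl_cases[OF assms(8)] .
  have f: "intertwines d f" and g: "intertwines d' g"
    using assms(9,10) by (simp_all add: \<eta> \<delta> coeff_space_W)
  obtain a1 b1 where \<eta>\<delta>: "\<eta> ** \<delta> = W (d = d') a1 b1"
    using W_mult_ex[of d a b d' a' b'] unfolding \<eta> \<delta> by blast
  have off: "offset (d = d') a1 b1 = offset d a b + (if d then offset d' a' b' else - offset d' a' b')"
    using offset_mult[OF \<eta>\<delta>[unfolded \<eta> \<delta>]] .
  show ?thesis
  proof (intro conjI allI impI)
    assume "len \<pi> (\<eta> ** \<delta>) = len \<pi> \<eta> + len \<pi> \<delta>"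
    then have "nat \<bar>offset (d = d') a1 b1\<bar> = nat \<bar>offset d a b\<bar> + nat \<bar>offset d' a' b'\<bar>"
      unfolding \<eta>\<delta> unfolding \<eta> \<delta> len_W .
    then have "\<bar>offset d a b + (if d then offset d' a' b' else - offset d' a' b')\<bar> =
        \<bar>offset d a b\<bar> + \<bar>offset d' a' b'\<bar>"
      unfolding off by linarith
    from convolution_additive[OF f g this]
    show "convolution val (hecke_elt smul val res \<sigma> \<eta> f) (hecke_elt smul val res \<sigma> \<delta> g)
          = hecke_elt smul val res \<sigma> (\<eta> ** \<delta>) (f \<circ> g)"
      unfolding \<eta> \<delta> .
  next
    fix \<eta>' v :: "('f, 'k) bmat"
    assume \<eta>': "\<eta>' \<in> Weyl \<pi> \<and> v \<in> simple_refls \<pi> \<and> \<eta> = \<eta>' ** v \<and> len \<pi> \<eta> = len \<pi> \<eta>' + 1"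
      and len: "len \<pi> \<eta> = 1 \<and> len \<pi> \<delta> = 1 \<and> len \<pi> (\<eta> ** \<delta>) = 0"
    obtain e c c' where W\<eta>': "\<eta>' = W e c c'"
      using \<eta>' Weyl_cases by blast
    \<comment> \<open>Removing \<open>v\<close> lowers the length from 1 to 0, so
      \<open>\<eta>'\<close> normalises \<open>P\<close>.\<close>
    have "nat \<bar>offset e c c'\<bar> = 0"
      using \<eta>' len unfolding W\<eta>' len_W by simp
    then have om': "omega e \<eta>'"
      by (auto simp: omega_def W\<eta>')
    have "nat \<bar>offset (d = d') a1 b1\<bar> = 0"
      using len unfolding \<eta>\<delta> len_W by simp
    then have om: "omega (d = d') (\<eta> ** \<delta>)"
      by (auto simp: omega_def \<eta>\<delta>)
    obtain ds s where s: "omega ds s" "v = s ** w0 ** matrix_inv s"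
      using \<eta>' simple_refl_omega by blast
    \<comment> \<open>With \<open>v = s ** w0 ** matrix_inv s\<close> this gives
      \<open>\<eta> = y ** w0 ** matrix_inv s\<close>. The condition
      \<open>y ** z = \<eta> ** \<delta>\<close> determines \<open>z\<close>, and
      \<open>\<delta> = s ** w0 ** z\<close> follows since \<open>w0\<close> is an
      involution.\<close>
    define y where "y = \<eta>' ** s"
    define z where "z = matrix_inv y ** (\<eta> ** \<delta>)"
    have y: "omega (e = ds) y"
      unfolding y_def by (rule omega_mult[OF om' s(1)])
    have z: "omega ((e = ds) = (d = d')) z"
      unfolding z_def by (rule omega_mult[OF omega_inv[OF y] om])
    have GL: "y \<in> GL" "s \<in> GL" "\<eta>' \<in> GL"
      using y s(1) om' omega_GL by auto
    have \<eta>_eq: "y ** w0 ** matrix_inv s = \<eta>"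
      using \<eta>' by (simp add: y_def s matrix_mul_assoc)
    have yz: "y ** z = \<eta> ** \<delta>"
      using GL by (simp add: z_def)
    have \<delta>_eq: "s ** w0 ** z = \<delta>"
      using GL unfolding z_def \<eta>_eq[symmetric] by (simp add: matrix_mul_assoc)
    have \<eta>'\<delta>: "y ** w0 ** z = \<eta>' ** \<delta>"
      unfolding \<delta>_eq[symmetric] y_def by (simp add: matrix_mul_assoc)
    from convolution_length_one[OF assms(6) y s(1) z \<eta>_eq[unfolded \<eta>] \<delta>_eq[unfolded \<delta>] f g]
    show "convolution val (hecke_elt smul val res \<sigma> \<eta> f) (hecke_elt smul val res \<sigma> \<delta> g)
          = (\<lambda>x u. smul (of_nat (CARD('q) ^ (CARD('k)\<^sup>2) mod CHAR('r)))
                         (hecke_elt smul val res \<sigma> (\<eta> ** \<delta>) (f \<circ> g) x u)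
                   + hecke_elt_T smul val res \<sigma> 1 (\<eta>' ** \<delta>) (f \<circ> g) x u)"
      unfolding \<eta>_eq \<delta>_eq yz \<eta>'\<delta> of_nat_mod_CHAR hecke_elt_T_def by simp
  qed
qed

end
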